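(* Let $\mathbb{K}$ be a field, $n\ge 2$ and $k\ge 1$ natural numbers, $p=k(n-1)+1$, and let $\mathcal{L}$ be a perfect Leibniz $n$-algebra over $\mathbb{K}$. Regard $\mathcal{L}$ and $\mathcal{L}^{\ast n}$ as Leibniz $p$-algebras via $\mathfrak{U}_n^p$, and let $\mathcal{L}^{\ast p}$ be the non-abelian tensor power of the Leibniz $p$-algebra $\mathfrak{U}_n^p(\mathcal{L})$. Then the map $\mathcal{L}^{\ast n}\to\mathcal{L}$, $x_1\ast\cdots\ast x_n\mapsto[x_1,\dots,x_n]$, is a central extension of Leibniz $p$-algebras, and there exists a unique homomorphism of Leibniz $p$-algebras $\phi:\mathcal{L}^{\ast p}\to\mathcal{L}^{\ast n}$ whose composite with $\mathcal{L}^{\ast n}\to\mathcal{L}$, $x_1\ast\cdots\ast x_n\mapsto[x_1,\dots,x_n]$, is the map $\mathcal{L}^{\ast p}\to\mathcal{L}$, $x_1\ast\cdots\ast x_p\mapsto[x_1,\dots,x_p]$. It is given by \[ \phi(x_1\ast\cdots\ast x_p)=x_1\ast\cdots\ast x_{n-1}\ast[x_n,\dots,x_{2n-2},[\dots,[x_{p-n+1},\dots,x_p]\dots]], \] and $\phi$ is surjective.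
   Context: A Leibniz $n$-algebra is a vector space $\mathcal{L}$ with an $n$-linear bracket satisfying $[[x_1,\dots,x_n],y_2,\dots,y_n]=\sum_{i=1}^n[x_1,\dots,[x_i,y_2,\dots,y_n],\dots,x_n]$. It is perfect if it is the linear span of its $n$-ary brackets. Its center $\mathsf{Z}(\mathcal{L})$ is the set of $l\in\mathcal{L}$ such that every $n$-ary bracket having $l$ as one of its entries (in any position) vanishes. A surjective homomorphism $\pi:\mathcal{K}\to\mathcal{L}$ of Leibniz $n$-algebras is a central extension of $\mathcal{L}$ if $\ker\pi\subseteq\mathsf{Z}(\mathcal{K})$. $\mathfrak{U}_n^p(\mathcal{L})$ is the Leibniz $p$-algebra with the same vector space $\mathcal{L}$ and bracket $[l_1,\dots,l_p]=[l_1,\dots,l_{n-1},[l_n,\dots,l_{2n-2},[\dots,[l_{p-n+1},\dots,l_p]\dots]]]$ ($k$ nested brackets; in the formula for $\phi$ the last factor consists of $k-1$ nested brackets, and is just $x_n$ if $k=1$). Non-abelian tensor power: for a Leibniz $n$-algebra $\mathcal{L}$, $\mathcal{L}^{\ast n}$ is the cokernel of $\delta_2:\mathcal{L}^{\otimes(2n-1)}\to\mathcal{L}^{\otimes n}$, \[ \delta_2(x_1\otimes\cdots\otimes x_{2n-1})=[x_1,\dots,x_n]\otimes x_{n+1}\otimes\cdots\otimes x_{2n-1}-\sum_{i=1}^n x_1\otimes\cdots\otimes[x_i,x_{n+1},\dots,x_{2n-1}]\otimes\cdots\otimes x_n, \] and $x_1\ast\cdots\ast x_n$ denotes the class of $x_1\otimes\cdots\otimes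 x_n$. It is known that $\mathcal{L}^{\ast n}$ is a Leibniz $n$-algebra with bracket \[ [x_{11}\ast\cdots\ast x_{n1},\dots,x_{1n}\ast\cdots\ast x_{nn}]=[x_{11},\dots,x_{n1}]\ast\cdots\ast[x_{1n},\dots,x_{nn}], \] and that if $\mathcal{L}$ is perfect, then $\mathcal{L}^{\ast n}\to\mathcal{L}$, $x_1\ast\cdots\ast x_n\mapsto[x_1,\dots,x_n]$, is the universal central extension of $\mathcal{L}$ among Leibniz $n$-algebras (for every central extension $\pi':\mathcal{K}'\to\mathcal{L}$ there is a unique homomorphism from it to $\mathcal{K}'$ over $\mathcal{L}$). The same definitions and facts apply with $p$ in place of $n$. *)

theory Defs
  imports "HOL-Algebra.Module" "HOL-Algebra.AbelCoset"
begin

text \<open>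
  Vector spaces over a field \<open>K\<close> are modules (\<^locale>\<open>module\<close>) over \<open>K\<close>. Elements of
  the \<open>n\<close>-fold cartesian power of a set are lists of length \<open>n\<close>, indexed from 0.
\<close>

definition tuples :: "nat \<Rightarrow> 'a set \<Rightarrow> 'a list set" where
  "tuples n S = {xs. set xs \<subseteq> S \<and> length xs = n}"


section \<open>Linear algebra\<close>

definition lin_hom ::
  "('k, 'c) ring_scheme \<Rightarrow> ('k, 'a, 'm) module_scheme \<Rightarrow> ('k, 'b, 'l) module_scheme
    \<Rightarrow> ('a \<Rightarrow> 'b) set" where
  "lin_hom K M N = {f \<in> carrier M \<rightarrow> carrier N.
     (\<forall>x\<in>carrier M. \<forall>y\<in>carrier M. f (x \<oplus>\<^bsub>M\<^esub> y) = f x \<oplus>\<^bsub>N\<^esub> f y) \<and>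
     (\<forall>a\<in>carrier K. \<forall>x\<in>carrier M. f (a \<odot>\<^bsub>M\<^esub> x) = a \<odot>\<^bsub>N\<^esub> f x)}"

definition multilinear ::
  "('k, 'c) ring_scheme \<Rightarrow> nat \<Rightarrow> ('k, 'a, 'm) module_scheme \<Rightarrow> ('k, 'b, 'l) module_scheme
    \<Rightarrow> ('a list \<Rightarrow> 'b) \<Rightarrow> bool" where
  "multilinear K n M N f \<longleftrightarrow>
     f \<in> tuples n (carrier M) \<rightarrow> carrier N \<and>
     (\<forall>xs\<in>tuples n (carrier M). \<forall>i<n. \<forall>x\<in>carrier M. \<forall>y\<in>carrier M.
        f (xs[i := x \<oplus>\<^bsub>M\<^esub> y]) = f (xs[i := x]) \<oplus>\<^bsub>N\<^esub> f (xs[i := y])) \<and>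
     (\<forall>xs\<in>tuples n (carrier M). \<forall>i<n. \<forall>a\<in>carrier K. \<forall>x\<in>carrier M.
        f (xs[i := a \<odot>\<^bsub>M\<^esub> x]) = a \<odot>\<^bsub>N\<^esub> f (xs[i := x]))"

definition lin_span ::
  "('k, 'c) ring_scheme \<Rightarrow> ('k, 'a, 'm) module_scheme \<Rightarrow> 'a set \<Rightarrow> 'a set" where
  "lin_span K M S = \<Inter>{H. submodule H K M \<and> S \<subseteq> H}"

text \<open>
  The linear map \<open>M \<rightarrow> N\<close> with \<open>g i \<mapsto> f i\<close> for \<open>i \<in> I\<close>, where the \<open>g i\<close> span \<open>M\<close>.
  Being in \<^const>\<open>extensional\<close> only fixes the irrelevant values outside the carrier.
\<close>

definition the_lin ::
  "('k, 'c) ring_scheme \<Rightarrow> ('k, 'a, 'm) module_scheme \<Rightarrow> ('k, 'b, 'l) module_scheme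
    \<Rightarrow> 'i set \<Rightarrow> ('i \<Rightarrow> 'a) \<Rightarrow> ('i \<Rightarrow> 'b) \<Rightarrow> 'a \<Rightarrow> 'b" where
  "the_lin K M N I g f =
     (THE h. h \<in> lin_hom K M N \<and> h \<in> extensional (carrier M) \<and> (\<forall>i\<in>I. h (g i) = f i))"

text \<open>
  The record type \<open>module\<close> extends \<open>ring\<close>; the multiplicative fields play no
  role for modules and are left unspecified.
\<close>

definition quot_module ::
  "('k, 'a, 'm) module_scheme \<Rightarrow> 'a set \<Rightarrow> ('k, 'a set) module" where
  "quot_module M H =
     \<lparr>carrier = a_rcosets\<^bsub>M\<^esub> H, monoid.mult = undefined, one = undefined,
      zero = H, add = set_add M,
      smult = (\<lambda>a C. \<Union>x\<in>C. H +>\<^bsub>M\<^esub> (a \<odot>\<^bsub>M\<^esub> x))\<rparr>"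

definition free_module :: "('k, 'c) ring_scheme \<Rightarrow> 'x set \<Rightarrow> ('k, 'x \<Rightarrow> 'k) module" where
  "free_module K X =
     \<lparr>carrier = {v. v \<in> X \<rightarrow> carrier K \<and> (\<forall>x. x \<notin> X \<longrightarrow> v x = \<zero>\<^bsub>K\<^esub>) \<and> finite {x. v x \<noteq> \<zero>\<^bsub>K\<^esub>}},
      monoid.mult = undefined, one = undefined,
      zero = (\<lambda>_. \<zero>\<^bsub>K\<^esub>), add = (\<lambda>v w x. v x \<oplus>\<^bsub>K\<^esub> w x),
      smult = (\<lambda>a v x. a \<otimes>\<^bsub>K\<^esub> v x)\<rparr>"

definition free_gen :: "('k, 'c) ring_scheme \<Rightarrow> 'x \<Rightarrow> 'x \<Rightarrow> 'k" where
  "free_gen K x = (\<lambda>y. if y = x then \<one>\<^bsub>K\<^esub> else \<zero>\<^bsub>K\<^esub>)"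


section \<open>Tensor powers of vector spaces\<close>

abbreviation free_tuples ::
  "('k, 'c) ring_scheme \<Rightarrow> nat \<Rightarrow> ('k, 'a, 'm) module_scheme \<Rightarrow> ('k, 'a list \<Rightarrow> 'k) module" where
  "free_tuples K n M \<equiv> free_module K (tuples n (carrier M))"

definition tensor_rels ::
  "('k, 'c) ring_scheme \<Rightarrow> nat \<Rightarrow> ('k, 'a, 'm) module_scheme \<Rightarrow> ('a list \<Rightarrow> 'k) set" where
  "tensor_rels K n M = lin_span K (free_tuples K n M)
     ({free_gen K (xs[i := x \<oplus>\<^bsub>M\<^esub> y]) \<ominus>\<^bsub>free_tuples K n M\<^esub>
         (free_gen K (xs[i := x]) \<oplus>\<^bsub>free_tuples K n M\<^esub> free_gen K (xs[i := y])) | xs i x y.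
        xs \<in> tuples n (carrier M) \<and> i < n \<and> x \<in> carrier M \<and> y \<in> carrier M} \<union>
      {free_gen K (xs[i := a \<odot>\<^bsub>M\<^esub> x]) \<ominus>\<^bsub>free_tuples K n M\<^esub>
         (a \<odot>\<^bsub>free_tuples K n M\<^esub> free_gen K (xs[i := x])) | xs i a x.
        xs \<in> tuples n (carrier M) \<and> i < n \<and> a \<in> carrier K \<and> x \<in> carrier M})"

definition tensor_power ::
  "('k, 'c) ring_scheme \<Rightarrow> nat \<Rightarrow> ('k, 'a, 'm) module_scheme
    \<Rightarrow> ('k, ('a list \<Rightarrow> 'k) set) module" where
  "tensor_power K n M = quot_module (free_tuples K n M) (tensor_rels K n M)"

text \<open>\<open>pure_tensor K n M [x\<^sub>1, \<dots>, x\<^sub>n]\<close> is \<open>x\<^sub>1 \<otimes> \<cdots> \<otimes> x\<^sub>n\<close>.\<close>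

definition pure_tensor ::
  "('k, 'c) ring_scheme \<Rightarrow> nat \<Rightarrow> ('k, 'a, 'm) module_scheme
    \<Rightarrow> 'a list \<Rightarrow> ('a list \<Rightarrow> 'k) set" where
  "pure_tensor K n M xs = tensor_rels K n M +>\<^bsub>free_tuples K n M\<^esub> free_gen K xs"


section \<open>Leibniz \<open>n\<close>-algebras\<close>

record ('k, 'a) leibniz = "('k, 'a) module" +
  bracket :: "'a list \<Rightarrow> 'a"

locale leibniz_algebra = field K + module K L
  for n :: nat and K (structure) and L :: "('k, 'a, 'm) leibniz_scheme" (structure) +
  assumes bracket_multilinear: "multilinear K n L L (bracket L)"
    and leibniz_identity:
      "\<lbrakk>xs \<in> tuples n (carrier L); ys \<in> tuples (n - 1) (carrier L)\<rbrakk> \<Longrightarrow>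
        bracket L (bracket L xs # ys) =
          (\<Oplus>\<^bsub>L\<^esub>i\<in>{..<n}. bracket L (xs[i := bracket L (xs ! i # ys)]))"

definition perfect ::
  "nat \<Rightarrow> ('k, 'c) ring_scheme \<Rightarrow> ('k, 'a, 'm) leibniz_scheme \<Rightarrow> bool" where
  "perfect n K L \<longleftrightarrow> lin_span K L (bracket L ` tuples n (carrier L)) = carrier L"

definition leibniz_center :: "nat \<Rightarrow> ('k, 'a, 'm) leibniz_scheme \<Rightarrow> 'a set" where
  "leibniz_center n L = {l \<in> carrier L.
     \<forall>xs\<in>tuples n (carrier L). l \<in> set xs \<longrightarrow> bracket L xs = \<zero>\<^bsub>L\<^esub>}"

definition leibniz_hom ::
  "nat \<Rightarrow> ('k, 'c) ring_scheme \<Rightarrow> ('k, 'a, 'm) leibniz_scheme \<Rightarrow> ('k, 'b, 'l) leibniz_scheme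
    \<Rightarrow> ('a \<Rightarrow> 'b) \<Rightarrow> bool" where
  "leibniz_hom n K A B f \<longleftrightarrow>
     leibniz_algebra n K A \<and> leibniz_algebra n K B \<and> f \<in> lin_hom K A B \<and>
     (\<forall>xs\<in>tuples n (carrier A). f (bracket A xs) = bracket B (map f xs))"

definition central_extension ::
  "nat \<Rightarrow> ('k, 'c) ring_scheme \<Rightarrow> ('k, 'a, 'm) leibniz_scheme \<Rightarrow> ('k, 'b, 'l) leibniz_scheme
    \<Rightarrow> ('a \<Rightarrow> 'b) \<Rightarrow> bool" where
  "central_extension n K A B \<pi> \<longleftrightarrow>
     leibniz_hom n K A B \<pi> \<and> \<pi> ` carrier A = carrier B \<and>
     a_kernel A B \<pi> \<subseteq> leibniz_center n A"


section \<open>The functor \<open>\<UU>\<^sub>n\<^sup>p\<close>\<close>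

text \<open>
  \<open>nested n k b\<close> takes a list of length \<open>k * (n - 1) + 1\<close> and applies the \<open>n\<close>-ary
  operation \<open>b\<close> nested \<open>k\<close> times; for \<open>k = 0\<close> it returns the only entry.
\<close>

fun nested :: "nat \<Rightarrow> nat \<Rightarrow> ('a list \<Rightarrow> 'a) \<Rightarrow> 'a list \<Rightarrow> 'a" where
  "nested n 0 b xs = hd xs"
| "nested n (Suc k) b xs = b (take (n - 1) xs @ [nested n k b (drop (n - 1) xs)])"

text \<open>\<open>forget n k L\<close> is \<open>\<UU>\<^sub>n\<^sup>p(L)\<close> for \<open>p = k * (n - 1) + 1\<close>.\<close>

definition forget ::
  "nat \<Rightarrow> nat \<Rightarrow> ('k, 'a, 'm) leibniz_scheme \<Rightarrow> ('k, 'a, 'm) leibniz_scheme" where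
  "forget n k L = L\<lparr>bracket := nested n k (bracket L)\<rparr>"


section \<open>Non-abelian tensor powers\<close>

definition delta2 ::
  "('k, 'c) ring_scheme \<Rightarrow> nat \<Rightarrow> ('k, 'a, 'm) leibniz_scheme
    \<Rightarrow> ('a list \<Rightarrow> 'k) set \<Rightarrow> ('a list \<Rightarrow> 'k) set" where
  "delta2 K n L =
     the_lin K (tensor_power K (2 * n - 1) L) (tensor_power K n L)
       (tuples (2 * n - 1) (carrier L)) (pure_tensor K (2 * n - 1) L)
       (\<lambda>zs. let xs = take n zs; ys = drop n zs in
          pure_tensor K n L (bracket L xs # ys) \<ominus>\<^bsub>tensor_power K n L\<^esub>
          (\<Oplus>\<^bsub>tensor_power K n L\<^esub>i\<in>{..<n}.
             pure_tensor K n L (xs[i := bracket L (xs ! i # ys)])))"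

definition delta2_range ::
  "('k, 'c) ring_scheme \<Rightarrow> nat \<Rightarrow> ('k, 'a, 'm) leibniz_scheme \<Rightarrow> ('a list \<Rightarrow> 'k) set set" where
  "delta2_range K n L = delta2 K n L ` carrier (tensor_power K (2 * n - 1) L)"

definition star_space ::
  "('k, 'c) ring_scheme \<Rightarrow> nat \<Rightarrow> ('k, 'a, 'm) leibniz_scheme
    \<Rightarrow> ('k, ('a list \<Rightarrow> 'k) set set) module" where
  "star_space K n L = quot_module (tensor_power K n L) (delta2_range K n L)"

text \<open>\<open>star K n L [x\<^sub>1, \<dots>, x\<^sub>n]\<close> is \<open>x\<^sub>1 * \<cdots> * x\<^sub>n\<close>.\<close>

definition star ::
  "('k, 'c) ring_scheme \<Rightarrow> nat \<Rightarrow> ('k, 'a, 'm) leibniz_scheme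
    \<Rightarrow> 'a list \<Rightarrow> ('a list \<Rightarrow> 'k) set set" where
  "star K n L xs = delta2_range K n L +>\<^bsub>tensor_power K n L\<^esub> pure_tensor K n L xs"

text \<open>
  The bracket is given on the spanning elements \<open>x\<^sub>1 * \<cdots> * x\<^sub>n\<close> and extended
  multilinearly.
\<close>

definition star_bracket ::
  "('k, 'c) ring_scheme \<Rightarrow> nat \<Rightarrow> ('k, 'a, 'm) leibniz_scheme
    \<Rightarrow> ('a list \<Rightarrow> 'k) set set list \<Rightarrow> ('a list \<Rightarrow> 'k) set set" where
  "star_bracket K n L =
     (THE b. multilinear K n (star_space K n L) (star_space K n L) b \<and>
        b \<in> extensional (tuples n (carrier (star_space K n L))) \<and>
        (\<forall>xss\<in>tuples n (tuples n (carrier L)).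
           b (map (star K n L) xss) = star K n L (map (bracket L) xss)))"

definition star_power ::
  "('k, 'c) ring_scheme \<Rightarrow> nat \<Rightarrow> ('k, 'a, 'm) leibniz_scheme
    \<Rightarrow> ('k, ('a list \<Rightarrow> 'k) set set) leibniz" where
  "star_power K n L =
     module.extend (star_space K n L) (leibniz.fields (star_bracket K n L))"

text \<open>The map \<open>x\<^sub>1 * \<cdots> * x\<^sub>n \<mapsto> [x\<^sub>1, \<dots>, x\<^sub>n]\<close>.\<close>

definition star_map ::
  "('k, 'c) ring_scheme \<Rightarrow> nat \<Rightarrow> ('k, 'a, 'm) leibniz_scheme
    \<Rightarrow> ('a list \<Rightarrow> 'k) set set \<Rightarrow> 'a" where
  "star_map K n L =
     the_lin K (star_power K n L) L (tuples n (carrier L)) (star K n L) (bracket L)"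

end

theory Submission
  imports Defs
begin

text \<open>
  Write \<open>d\<close> for the map \<open>x\<^sub>1 * \<cdots> * x\<^sub>n \<mapsto> [x\<^sub>1, \<dots>, x\<^sub>n]\<close>. The bracket of the tensor power is
  \<open>[t\<^sub>1, \<dots>, t\<^sub>n] = d t\<^sub>1 * \<cdots> * d t\<^sub>n\<close>, so brackets only depend on images under \<open>d\<close>; hence the kernel
  of \<open>d\<close> is central, and a homomorphism over \<open>L\<close> is determined on brackets, which span the
  tensor power when \<open>L\<close> is perfect. The same formula gives, for \<open>k\<close> nested brackets,
  \<open>[t\<^sub>1, \<dots>, t\<^sub>p] = F (d t\<^sub>1, \<dots>, d t\<^sub>p)\<close> with
  \<open>F (x\<^sub>1, \<dots>, x\<^sub>p) = x\<^sub>1 * \<cdots> * x\<^bsub>n-1\<^esub> * [x\<^sub>n, \<dots>, x\<^sub>p]\<close>. That \<open>F\<close> factors through the \<open>p\<close>-fold tensor power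
  amounts to the fact that \<open>[-, y\<^sub>2, \<dots>, y\<^sub>p]\<close> equals \<open>[-, z\<^sub>2, \<dots>, z\<^sub>n]\<close> for suitable \<open>z\<^sub>i\<close>, which is a
  derivation of the \<open>n\<close>-ary bracket and therefore of nested brackets.
\<close>

section \<open>Linear maps\<close>

text \<open>The maps \<open>delta2\<close>, \<open>star_bracket\<close> and \<open>star_map\<close>
  are definite descriptions, which say nothing until a map with the described property is known to
  exist. Existence is always drawn from a universal property (free module, quotient, tensor power,
  cokernel) and uniqueness from a spanning set, so both are set up for arbitrary modules.

  One condition, \<open>leibniz_balanced\<close>, carries the algebra: for the bracket it is the
  Leibniz identity, for \<open>star\<close> it is the relation imposed by the cokernel, and a
  multilinear map with this property descends to the tensor power. The p-ary bracket of L and the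
  map F are both some g applied after \<open>nest_last\<close>, with g the n-ary bracket or
  \<open>star\<close>. A single computation shows that such a composite is balanced for arity p,
  which makes L a Leibniz p-algebra and also produces \<phi>. Here n \<ge> 2 is decisive: the first
  of the p entries then stays outside the inner brackets.

  Surjectivity of \<phi> rests on perfectness: the (k-1)-fold nested brackets span L, so they
  suffice as last factors of the generators of the n-fold power.\<close>

lemma lin_homI:
  assumes "\<And>x. x \<in> carrier M \<Longrightarrow> f x \<in> carrier N"
    and "\<And>x y. x \<in> carrier M \<Longrightarrow> y \<in> carrier M \<Longrightarrow> f (x \<oplus>\<^bsub>M\<^esub> y) = f x \<oplus>\<^bsub>N\<^esub> f y"
    and "\<And>a x. a \<in> carrier K \<Longrightarrow> x \<in> carrier M \<Longrightarrow> f (a \<odot>\<^bsub>M\<^esub> x) = a \<odot>\<^bsub>N\<^esub> f x"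
  shows "f \<in> lin_hom K M N"
  using assms by (auto simp: lin_hom_def)

lemma lin_hom_closed: "f \<in> lin_hom K M N \<Longrightarrow> x \<in> carrier M \<Longrightarrow> f x \<in> carrier N"
  and lin_hom_add: "f \<in> lin_hom K M N \<Longrightarrow> x \<in> carrier M \<Longrightarrow> y \<in> carrier M \<Longrightarrow>
    f (x \<oplus>\<^bsub>M\<^esub> y) = f x \<oplus>\<^bsub>N\<^esub> f y"
  and lin_hom_smult: "f \<in> lin_hom K M N \<Longrightarrow> a \<in> carrier K \<Longrightarrow> x \<in> carrier M \<Longrightarrow>
    f (a \<odot>\<^bsub>M\<^esub> x) = a \<odot>\<^bsub>N\<^esub> f x"
  by (auto simp: lin_hom_def)

text \<open>Linearity sees only values on the carrier. This matters because a map picked by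
  \<open>the_lin\<close> is a restriction and agrees with the intended map only there.\<close>

lemma lin_hom_cong:
  assumes "module K M" "\<And>x. x \<in> carrier M \<Longrightarrow> f x = g x" "f \<in> lin_hom K M N"
  shows "g \<in> lin_hom K M N"
proof -
  interpret M: module K M by fact
  show ?thesis
    using assms(2,3) by (auto simp: lin_hom_def Pi_def)
qed

lemma lin_hom_zero:
  assumes "module K M" "module K N" "f \<in> lin_hom K M N"
  shows "f \<zero>\<^bsub>M\<^esub> = \<zero>\<^bsub>N\<^esub>"
proof -
  interpret M: module K M by fact
  interpret N: module K N by fact
  have "f (\<zero>\<^bsub>K\<^esub> \<odot>\<^bsub>M\<^esub> \<zero>\<^bsub>M\<^esub>) = \<zero>\<^bsub>K\<^esub> \<odot>\<^bsub>N\<^esub> f \<zero>\<^bsub>M\<^esub>"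
    by (rule lin_hom_smult[OF assms(3)]) auto
  then show ?thesis
    using lin_hom_closed[OF assms(3)] by simp
qed

lemma lin_hom_minus:
  assumes "module K M" "module K N" "f \<in> lin_hom K M N" "x \<in> carrier M"
  shows "f (\<ominus>\<^bsub>M\<^esub> x) = \<ominus>\<^bsub>N\<^esub> f x"
proof -
  interpret M: module K M by fact
  interpret N: module K N by fact
  have "f ((\<ominus>\<^bsub>K\<^esub> \<one>\<^bsub>K\<^esub>) \<odot>\<^bsub>M\<^esub> x) = (\<ominus>\<^bsub>K\<^esub> \<one>\<^bsub>K\<^esub>) \<odot>\<^bsub>N\<^esub> f x"
    by (rule lin_hom_smult[OF assms(3)]) (use assms in auto)
  then show ?thesis
    using lin_hom_closed[OF assms(3)] assms(4) by (simp add: M.smult_l_minus N.smult_l_minus)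
qed

lemma lin_hom_diff:
  assumes "module K M" "module K N" "f \<in> lin_hom K M N" "x \<in> carrier M" "y \<in> carrier M"
  shows "f (x \<ominus>\<^bsub>M\<^esub> y) = f x \<ominus>\<^bsub>N\<^esub> f y"
proof -
  interpret M: module K M by fact
  interpret N: module K N by fact
  show ?thesis
    using assms by (simp add: M.minus_eq N.minus_eq lin_hom_add lin_hom_minus)
qed

lemma lin_hom_finsum:
  assumes "module K M" "module K N" "f \<in> lin_hom K M N" "g \<in> I \<rightarrow> carrier M"
  shows "f (\<Oplus>\<^bsub>M\<^esub>i\<in>I. g i) = (\<Oplus>\<^bsub>N\<^esub>i\<in>I. f (g i))"
proof -
  interpret M: module K M by fact
  interpret N: module K N by fact
  show ?thesis
    using assms(4)
  proof (induction I rule: infinite_finite_induct)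
    \<comment> \<open>A \<open>finsum\<close> over an infinite index set is zero by convention, so
      this case is preservation of zero.\<close>
    case (infinite A)
    then show ?case by (simp add: lin_hom_zero[OF assms(1-3)])
  next
    case empty
    then show ?case by (simp add: lin_hom_zero[OF assms(1-3)])
  next
    case (insert i A)
    have "(\<lambda>i. f (g i)) \<in> A \<rightarrow> carrier N" "f (g i) \<in> carrier N"
      using insert.prems lin_hom_closed[OF assms(3)] by auto
    then show ?case
      using insert by (simp add: lin_hom_add[OF assms(3)] Pi_def)
  qed
qed

lemma lin_hom_comp:
  "f \<in> lin_hom K M N \<Longrightarrow> g \<in> lin_hom K N P \<Longrightarrow> (\<lambda>x. g (f x)) \<in> lin_hom K M P"
  by (auto simp: lin_hom_def Pi_def)

lemma lin_hom_fun_diff: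
  assumes "module K N" "f \<in> lin_hom K M N" "g \<in> lin_hom K M N"
  shows "(\<lambda>x. f x \<ominus>\<^bsub>N\<^esub> g x) \<in> lin_hom K M N"
proof -
  interpret N: module K N by fact
  show ?thesis
    by (rule lin_homI)
      (auto simp: lin_hom_add[OF assms(2)] lin_hom_add[OF assms(3)] lin_hom_smult[OF assms(2)]
        lin_hom_smult[OF assms(3)] lin_hom_closed[OF assms(2)] lin_hom_closed[OF assms(3)]
        N.minus_eq N.smult_r_distr N.smult_r_minus N.minus_add N.a_ac)
qed

lemma lin_hom_fun_finsum:
  assumes "module K N" "finite I" "\<And>i. i \<in> I \<Longrightarrow> f i \<in> lin_hom K M N"
  shows "(\<lambda>x. \<Oplus>\<^bsub>N\<^esub>i\<in>I. f i x) \<in> lin_hom K M N"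
proof -
  interpret N: module K N by fact
  have cl: "f i x \<in> carrier N" if "i \<in> I" "x \<in> carrier M" for i x
    using lin_hom_closed[OF assms(3)] that .
  show ?thesis
  proof (rule lin_homI)
    fix x assume x: "x \<in> carrier M"
    show "(\<Oplus>\<^bsub>N\<^esub>i\<in>I. f i x) \<in> carrier N"
      using cl x by (auto intro: N.finsum_closed)
    fix y assume y: "y \<in> carrier M"
    have "(\<Oplus>\<^bsub>N\<^esub>i\<in>I. f i (x \<oplus>\<^bsub>M\<^esub> y)) = (\<Oplus>\<^bsub>N\<^esub>i\<in>I. f i x \<oplus>\<^bsub>N\<^esub> f i y)"
      by (rule N.finsum_cong') (use cl x y lin_hom_add[OF assms(3)] in auto)
    also have "\<dots> = (\<Oplus>\<^bsub>N\<^esub>i\<in>I. f i x) \<oplus>\<^bsub>N\<^esub> (\<Oplus>\<^bsub>N\<^esub>i\<in>I. f i y)"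
      by (rule N.finsum_addf) (use cl x y in auto)
    finally show "(\<Oplus>\<^bsub>N\<^esub>i\<in>I. f i (x \<oplus>\<^bsub>M\<^esub> y)) = (\<Oplus>\<^bsub>N\<^esub>i\<in>I. f i x) \<oplus>\<^bsub>N\<^esub> (\<Oplus>\<^bsub>N\<^esub>i\<in>I. f i y)" .
  next
    fix a x assume a: "a \<in> carrier K" and x: "x \<in> carrier M"
    have "(\<Oplus>\<^bsub>N\<^esub>i\<in>I. f i (a \<odot>\<^bsub>M\<^esub> x)) = (\<Oplus>\<^bsub>N\<^esub>i\<in>I. a \<odot>\<^bsub>N\<^esub> f i x)"
      by (rule N.finsum_cong') (use cl a x lin_hom_smult[OF assms(3)] in auto)
    also have "\<dots> = a \<odot>\<^bsub>N\<^esub> (\<Oplus>\<^bsub>N\<^esub>i\<in>I. f i x)"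
      by (rule N.finsum_smult_ldistr[symmetric]) (use assms cl a x in auto)
    finally show "(\<Oplus>\<^bsub>N\<^esub>i\<in>I. f i (a \<odot>\<^bsub>M\<^esub> x)) = a \<odot>\<^bsub>N\<^esub> (\<Oplus>\<^bsub>N\<^esub>i\<in>I. f i x)" .
  qed
qed

section \<open>Submodules, spans, and maps determined on a spanning set\<close>

lemma submodule_vimage:
  assumes "module K M" "module K N" "f \<in> lin_hom K M N" "submodule H K N"
  shows "submodule {x \<in> carrier M. f x \<in> H} K M"
proof -
  interpret M: module K M by fact
  interpret N: module K N by fact
  note H = N.submoduleE[OF assms(4)]
  have "\<zero>\<^bsub>N\<^esub> \<in> H"
    using submodule.axioms(1)[OF assms(4)] subgroup.one_closed by fastforce
  then show ?thesis
    by (intro M.submoduleI)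
      (use H assms(3) in \<open>auto simp: lin_hom_zero[OF assms(1-3)] lin_hom_minus[OF assms(1-3)]
        lin_hom_add lin_hom_smult\<close>)
qed

lemma submodule_image:
  assumes "module K M" "module K N" "f \<in> lin_hom K M N"
  shows "submodule (f ` carrier M) K N"
proof -
  interpret M: module K M by fact
  interpret N: module K N by fact
  show ?thesis
  proof (rule N.submoduleI)
    show "f ` carrier M \<subseteq> carrier N" using lin_hom_closed[OF assms(3)] by auto
    show "\<zero>\<^bsub>N\<^esub> \<in> f ` carrier M"
      using lin_hom_zero[OF assms] by (metis M.zero_closed imageI)
    show "\<ominus>\<^bsub>N\<^esub> a \<in> f ` carrier M" if "a \<in> f ` carrier M" for a
      using that lin_hom_minus[OF assms] by (metis (no_types, lifting) M.a_inv_closed imageE imageI)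
    show "a \<oplus>\<^bsub>N\<^esub> b \<in> f ` carrier M" if "a \<in> f ` carrier M" "b \<in> f ` carrier M" for a b
      using that by (auto simp: lin_hom_add[OF assms(3), symmetric])
    show "a \<odot>\<^bsub>N\<^esub> b \<in> f ` carrier M" if "a \<in> carrier K" "b \<in> f ` carrier M" for a b
      using that by (auto simp: lin_hom_smult[OF assms(3), symmetric])
  qed
qed

lemma submodule_equalizer:
  assumes "module K M" "module K N" "f \<in> lin_hom K M N" "g \<in> lin_hom K M N"
  shows "submodule {x \<in> carrier M. f x = g x} K M"
proof -
  interpret M: module K M by fact
  interpret N: module K N by fact
  show ?thesis
    by (rule M.submoduleI)
      (use assms in \<open>auto simp: lin_hom_zero lin_hom_minus lin_hom_add lin_hom_smult\<close>)
qed

lemma submodule_singleton_zero: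
  assumes "module K M" shows "submodule {\<zero>\<^bsub>M\<^esub>} K M"
proof -
  interpret M: module K M by fact
  show ?thesis by (rule M.submoduleI) auto
qed

lemma submodule_zero_closed: "submodule H K M \<Longrightarrow> \<zero>\<^bsub>M\<^esub> \<in> H"
  using submodule.axioms(1) subgroup.one_closed by fastforce

lemma submodule_subset: "submodule H K M \<Longrightarrow> H \<subseteq> carrier M"
  using submodule.axioms(1) subgroup.subset by fastforce

lemma lin_span_superset: "S \<subseteq> lin_span K M S"
  by (auto simp: lin_span_def)

lemma lin_span_least: "submodule H K M \<Longrightarrow> S \<subseteq> H \<Longrightarrow> lin_span K M S \<subseteq> H"
  by (auto simp: lin_span_def)

lemma submodule_lin_span:
  assumes "module K M" "S \<subseteq> carrier M"
  shows "submodule (lin_span K M S) K M"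
proof -
  interpret M: module K M by fact
  have "carrier M \<in> {H. submodule H K M \<and> S \<subseteq> H}"
    using M.carrier_is_submodule assms(2) by auto
  then have "lin_span K M S \<subseteq> carrier M" by (auto simp: lin_span_def)
  then show ?thesis
    by (rule M.submoduleI)
      (auto simp: lin_span_def submodule_zero_closed M.submoduleE(3-5))
qed

lemma lin_span_eq_carrierI:
  assumes "module K M" "S \<subseteq> carrier M"
    and "\<And>H. submodule H K M \<Longrightarrow> S \<subseteq> H \<Longrightarrow> carrier M \<subseteq> H"
  shows "lin_span K M S = carrier M"
  using assms(3)[OF submodule_lin_span[OF assms(1,2)] lin_span_superset]
    submodule_subset[OF submodule_lin_span[OF assms(1,2)]] by auto

text \<open>The induction principle for spanning sets: a property that cuts out a submodule has to
  be checked on \<open>S\<close> only. The submodules used with it are preimages, images and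
  equalizers of linear maps.\<close>

lemma lin_span_carrier_subset:
  "lin_span K M S = carrier M \<Longrightarrow> submodule H K M \<Longrightarrow> S \<subseteq> H \<Longrightarrow> carrier M \<subseteq> H"
  using lin_span_least by metis

lemma lin_hom_eq_on_span:
  assumes "module K M" "module K N" "f \<in> lin_hom K M N" "g \<in> lin_hom K M N"
    and "lin_span K M S = carrier M" "\<And>x. x \<in> S \<Longrightarrow> f x = g x" "x \<in> carrier M"
  shows "f x = g x"
proof -
  have "S \<subseteq> carrier M" using lin_span_superset assms(5) by metis
  then have "S \<subseteq> {x \<in> carrier M. f x = g x}" using assms(6) by auto
  from lin_span_carrier_subset[OF assms(5) submodule_equalizer[OF assms(1-4)] this] assms(7)
  show ?thesis by auto
qed

text \<open>Moves spanning sets along the two quotient maps, from free generators to pure tensors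
  and from pure tensors to \<open>star\<close> elements.\<close>

lemma lin_span_surj_image:
  assumes "module K M" "module K N" "f \<in> lin_hom K M N" "f ` carrier M = carrier N"
    and "lin_span K M S = carrier M"
  shows "lin_span K N (f ` S) = carrier N"
proof (rule lin_span_eq_carrierI)
  have S: "S \<subseteq> carrier M" using lin_span_superset assms(5) by metis
  then show "f ` S \<subseteq> carrier N" using assms(4) by auto
  fix H assume H: "submodule H K N" "f ` S \<subseteq> H"
  have "S \<subseteq> {x \<in> carrier M. f x \<in> H}" using H S by auto
  from lin_span_carrier_subset[OF assms(5) submodule_vimage[OF assms(1-3) H(1)] this]
  have "f ` carrier M \<subseteq> H" by auto
  then show "carrier N \<subseteq> H" by (simp only: assms(4))
qed fact

text \<open>The span gives uniqueness and the supplied \<open>h\<close> gives existence;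
  \<open>extensional\<close> fixes the values off the carrier, so the description evaluates to a
  restriction of \<open>h\<close>.\<close>

lemma the_lin_eqI:
  assumes "module K M" "module K N" "lin_span K M (g ` I) = carrier M"
    and h: "h \<in> lin_hom K M N" "\<And>i. i \<in> I \<Longrightarrow> h (g i) = f i"
  shows "the_lin K M N I g f = restrict h (carrier M)"
  unfolding the_lin_def
proof (rule the_equality)
  have gI: "g ` I \<subseteq> carrier M" using lin_span_superset assms(3) by metis
  have "restrict h (carrier M) \<in> lin_hom K M N"
    by (rule lin_hom_cong[OF assms(1) _ h(1)]) simp
  then show "restrict h (carrier M) \<in> lin_hom K M N \<and>
      restrict h (carrier M) \<in> extensional (carrier M) \<and>
      (\<forall>i\<in>I. restrict h (carrier M) (g i) = f i)"
    using h(2) gI by auto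
  fix h' assume h': "h' \<in> lin_hom K M N \<and> h' \<in> extensional (carrier M) \<and> (\<forall>i\<in>I. h' (g i) = f i)"
  show "h' = restrict h (carrier M)"
  proof (rule extensionalityI)
    fix x assume x: "x \<in> carrier M"
    have "h' x = h x"
      by (rule lin_hom_eq_on_span[OF assms(1,2) _ h(1) assms(3) _ x]) (use h' h(2) in auto)
    then show "h' x = restrict h (carrier M) x" using x by simp
  qed (use h' in auto)
qed

lemma the_lin:
  assumes "module K M" "module K N" "lin_span K M (g ` I) = carrier M"
    and h: "h \<in> lin_hom K M N" "\<And>i. i \<in> I \<Longrightarrow> h (g i) = f i"
  shows "the_lin K M N I g f \<in> lin_hom K M N"
    and "i \<in> I \<Longrightarrow> the_lin K M N I g f (g i) = f i"
proof -
  have gI: "g ` I \<subseteq> carrier M" using lin_span_superset assms(3) by metis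
  show "the_lin K M N I g f \<in> lin_hom K M N"
    by (rule lin_hom_cong[OF assms(1) _ h(1)]) (simp add: the_lin_eqI[OF assms(1-3) h])
  show "i \<in> I \<Longrightarrow> the_lin K M N I g f (g i) = f i"
    using gI h(2) by (auto simp: the_lin_eqI[OF assms(1-3) h])
qed

section \<open>Quotients and free modules\<close>

lemma abelian_subgroup_of_submodule:
  assumes "module K M" "submodule H K M"
  shows "abelian_subgroup H M"
  by (intro abelian_subgroupI3 additive_subgroupI submodule.axioms(1)[OF assms(2)]
      module.axioms(2)[OF assms(1)])

text \<open>The scalar multiple of a coset is defined as a union over all its representatives. Two
  representatives differ by some \<open>h\<close> in \<open>H\<close>, and scalar multiples of
  \<open>h\<close> stay in \<open>H\<close>, so every member of the union is the same coset.\<close>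

lemma quot_smult:
  assumes "module K M" "submodule H K M" "a \<in> carrier K" "x \<in> carrier M"
  shows "a \<odot>\<^bsub>quot_module M H\<^esub> (H +>\<^bsub>M\<^esub> x) = H +>\<^bsub>M\<^esub> (a \<odot>\<^bsub>M\<^esub> x)"
proof -
  interpret M: module K M by fact
  interpret H: abelian_subgroup H M by (rule abelian_subgroup_of_submodule) fact+
  have "H +>\<^bsub>M\<^esub> (a \<odot>\<^bsub>M\<^esub> y) = H +>\<^bsub>M\<^esub> (a \<odot>\<^bsub>M\<^esub> x)" if y: "y \<in> H +>\<^bsub>M\<^esub> x" for y
  proof -
    obtain h where h: "h \<in> H" "y = h \<oplus>\<^bsub>M\<^esub> x"
      using y by (auto simp: a_r_coset_def')
    have "a \<odot>\<^bsub>M\<^esub> y = a \<odot>\<^bsub>M\<^esub> h \<oplus>\<^bsub>M\<^esub> a \<odot>\<^bsub>M\<^esub> x"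
      using h assms(3,4) by (simp add: M.smult_r_distr)
    moreover have "a \<odot>\<^bsub>M\<^esub> h \<in> H"
      using M.submoduleE(4)[OF assms(2)] h assms(3) by auto
    ultimately have "a \<odot>\<^bsub>M\<^esub> y \<in> H +>\<^bsub>M\<^esub> (a \<odot>\<^bsub>M\<^esub> x)"
      by (auto simp: a_r_coset_def')
    from M.a_repr_independence[OF this _ H.a_subgroup] show ?thesis using assms by simp
  qed
  moreover have "x \<in> H +>\<^bsub>M\<^esub> x" by (rule H.a_rcos_self) fact
  ultimately have "(\<Union>y\<in>H +>\<^bsub>M\<^esub> x. H +>\<^bsub>M\<^esub> (a \<odot>\<^bsub>M\<^esub> y)) = H +>\<^bsub>M\<^esub> (a \<odot>\<^bsub>M\<^esub> x)"
    by blast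
  then show ?thesis
    by (simp add: quot_module_def)
qed

lemma quot_add:
  assumes "module K M" "submodule H K M" "x \<in> carrier M" "y \<in> carrier M"
  shows "(H +>\<^bsub>M\<^esub> x) \<oplus>\<^bsub>quot_module M H\<^esub> (H +>\<^bsub>M\<^esub> y) = H +>\<^bsub>M\<^esub> (x \<oplus>\<^bsub>M\<^esub> y)"
  using abelian_subgroup.a_rcos_sum[OF abelian_subgroup_of_submodule[OF assms(1,2)] assms(3,4)]
  by (simp add: quot_module_def)

lemma quot_carrier: "carrier (quot_module M H) = (\<lambda>x. H +>\<^bsub>M\<^esub> x) ` carrier M"
  by (auto simp: quot_module_def A_RCOSETS_def')

lemma quot_zero:
  assumes "module K M" "submodule H K M"
  shows "\<zero>\<^bsub>quot_module M H\<^esub> = H +>\<^bsub>M\<^esub> \<zero>\<^bsub>M\<^esub>"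
proof -
  interpret M: module K M by fact
  show ?thesis using submodule_subset[OF assms(2)] by (simp add: quot_module_def)
qed

lemma module_quot:
  assumes "module K M" "submodule H K M"
  shows "module K (quot_module M H)"
proof -
  interpret M: module K M by fact
  note add = quot_add[OF assms] and smult = quot_smult[OF assms] and zero = quot_zero[OF assms]
  show ?thesis
  proof (rule moduleI)
    show "abelian_group (quot_module M H)"
    proof (rule abelian_groupI)
      fix x assume "x \<in> carrier (quot_module M H)"
      then obtain u where u: "u \<in> carrier M" "x = H +>\<^bsub>M\<^esub> u" by (auto simp: quot_carrier)
      have "(H +>\<^bsub>M\<^esub> (\<ominus>\<^bsub>M\<^esub> u)) \<oplus>\<^bsub>quot_module M H\<^esub> x = \<zero>\<^bsub>quot_module M H\<^esub>"
        using u by (simp add: add zero M.l_neg)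
      then show "\<exists>y\<in>carrier (quot_module M H). y \<oplus>\<^bsub>quot_module M H\<^esub> x = \<zero>\<^bsub>quot_module M H\<^esub>"
        using u by (auto simp: quot_carrier)
    qed (auto simp: quot_carrier add zero M.a_ac)
  qed (auto simp: quot_carrier add smult M.is_cring M.smult_l_distr M.smult_r_distr M.smult_assoc1)
qed

lemma quot_map_lin_hom:
  assumes "module K M" "submodule H K M"
  shows "(\<lambda>x. H +>\<^bsub>M\<^esub> x) \<in> lin_hom K M (quot_module M H)"
  by (rule lin_homI) (auto simp: quot_carrier quot_add[OF assms] quot_smult[OF assms])

lemma quot_map_eq_zero:
  assumes "module K M" "submodule H K M" "x \<in> H"
  shows "H +>\<^bsub>M\<^esub> x = \<zero>\<^bsub>quot_module M H\<^esub>"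
proof -
  interpret M: module K M by fact
  interpret H: abelian_subgroup H M by (rule abelian_subgroup_of_submodule) fact+
  show ?thesis
    using M.a_coset_join2[OF _ H.a_subgroup assms(3)] assms(3) by (simp add: quot_module_def)
qed

text \<open>A linear map that kills \<open>H\<close> is constant on cosets, so it may be evaluated
  at an arbitrarily chosen representative.\<close>

lemma quot_lift:
  assumes "module K M" "submodule H K M" "module K N" "f \<in> lin_hom K M N"
    and vanish: "\<And>x. x \<in> H \<Longrightarrow> f x = \<zero>\<^bsub>N\<^esub>"
  shows "\<exists>h\<in>lin_hom K (quot_module M H) N. \<forall>x\<in>carrier M. h (H +>\<^bsub>M\<^esub> x) = f x"
proof -
  interpret M: module K M by fact
  interpret N: module K N by fact
  interpret H: abelian_subgroup H M by (rule abelian_subgroup_of_submodule) fact+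
  define h where "h C = f (SOME x. x \<in> C)" for C
  have h: "h (H +>\<^bsub>M\<^esub> x) = f x" if x: "x \<in> carrier M" for x
  proof -
    have "(SOME y. y \<in> H +>\<^bsub>M\<^esub> x) \<in> H +>\<^bsub>M\<^esub> x"
      by (rule someI) (rule H.a_rcos_self[OF x])
    then obtain u where "u \<in> H" "(SOME y. y \<in> H +>\<^bsub>M\<^esub> x) = u \<oplus>\<^bsub>M\<^esub> x"
      by (auto simp: a_r_coset_def')
    then show ?thesis
      using x by (simp add: h_def lin_hom_add[OF assms(4)] vanish lin_hom_closed[OF assms(4)])
  qed
  have "h \<in> lin_hom K (quot_module M H) N"
    by (rule lin_homI)
      (auto simp: quot_carrier h quot_add[OF assms(1,2)] quot_smult[OF assms(1,2)]
        lin_hom_add[OF assms(4)] lin_hom_smult[OF assms(4)] lin_hom_closed[OF assms(4)])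
  with h show ?thesis by blast
qed

section \<open>Free modules as finitely supported functions\<close>

lemma free_module_simps:
  "carrier (free_module K X) =
    {v. v \<in> X \<rightarrow> carrier K \<and> (\<forall>x. x \<notin> X \<longrightarrow> v x = \<zero>\<^bsub>K\<^esub>) \<and> finite {x. v x \<noteq> \<zero>\<^bsub>K\<^esub>}}"
  "\<zero>\<^bsub>free_module K X\<^esub> = (\<lambda>_. \<zero>\<^bsub>K\<^esub>)"
  "v \<oplus>\<^bsub>free_module K X\<^esub> w = (\<lambda>x. v x \<oplus>\<^bsub>K\<^esub> w x)"
  "a \<odot>\<^bsub>free_module K X\<^esub> v = (\<lambda>x. a \<otimes>\<^bsub>K\<^esub> v x)"
  by (auto simp: free_module_def)

lemma free_module_carrier_iff:
  assumes "cring K"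
  shows "v \<in> carrier (free_module K X) \<longleftrightarrow>
    (\<forall>x. v x \<in> carrier K) \<and> {x. v x \<noteq> \<zero>\<^bsub>K\<^esub>} \<subseteq> X \<and> finite {x. v x \<noteq> \<zero>\<^bsub>K\<^esub>}"
proof -
  interpret K: cring K by fact
  show ?thesis
    unfolding free_module_simps by (auto simp: Pi_def)
qed

lemma module_free:
  assumes "cring K" shows "module K (free_module K X)"
proof -
  interpret K: cring K by fact
  note iff = free_module_carrier_iff[OF assms]
  show ?thesis
  proof (rule moduleI)
    show "abelian_group (free_module K X)"
    proof (rule abelian_groupI)
      fix v assume v: "v \<in> carrier (free_module K X)"
      have "{x. \<ominus>\<^bsub>K\<^esub> v x \<noteq> \<zero>\<^bsub>K\<^esub>} \<subseteq> {x. v x \<noteq> \<zero>\<^bsub>K\<^esub>}" by auto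
      then have "(\<lambda>x. \<ominus>\<^bsub>K\<^esub> v x) \<in> carrier (free_module K X)"
        using v by (auto simp: iff intro: finite_subset)
      moreover have "(\<lambda>x. \<ominus>\<^bsub>K\<^esub> v x) \<oplus>\<^bsub>free_module K X\<^esub> v = \<zero>\<^bsub>free_module K X\<^esub>"
        using v by (auto simp: iff free_module_simps(2-) K.l_neg)
      ultimately show "\<exists>w\<in>carrier (free_module K X). w \<oplus>\<^bsub>free_module K X\<^esub> v = \<zero>\<^bsub>free_module K X\<^esub>"
        by blast
      fix w assume w: "w \<in> carrier (free_module K X)"
      have "{x. v x \<oplus>\<^bsub>K\<^esub> w x \<noteq> \<zero>\<^bsub>K\<^esub>} \<subseteq> {x. v x \<noteq> \<zero>\<^bsub>K\<^esub>} \<union> {x. w x \<noteq> \<zero>\<^bsub>K\<^esub>}" by auto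
      moreover have "finite ({x. v x \<noteq> \<zero>\<^bsub>K\<^esub>} \<union> {x. w x \<noteq> \<zero>\<^bsub>K\<^esub>})" using v w by (auto simp: iff)
      ultimately have "{x. v x \<oplus>\<^bsub>K\<^esub> w x \<noteq> \<zero>\<^bsub>K\<^esub>} \<subseteq> X \<and> finite {x. v x \<oplus>\<^bsub>K\<^esub> w x \<noteq> \<zero>\<^bsub>K\<^esub>}"
        using v w finite_subset unfolding iff by blast
      then show "v \<oplus>\<^bsub>free_module K X\<^esub> w \<in> carrier (free_module K X)"
        using v w by (simp add: iff free_module_simps(2-))
    qed (auto simp: iff free_module_simps(2-) K.a_ac)
    fix a v assume a: "a \<in> carrier K" and v: "v \<in> carrier (free_module K X)"
    have "{x. a \<otimes>\<^bsub>K\<^esub> v x \<noteq> \<zero>\<^bsub>K\<^esub>} \<subseteq> {x. v x \<noteq> \<zero>\<^bsub>K\<^esub>}" using a by auto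
    moreover from this have "finite {x. a \<otimes>\<^bsub>K\<^esub> v x \<noteq> \<zero>\<^bsub>K\<^esub>}"
      using v by (auto simp: iff intro: finite_subset)
    ultimately show "a \<odot>\<^bsub>free_module K X\<^esub> v \<in> carrier (free_module K X)"
      using a v by (auto simp: iff free_module_simps(2-))
  qed (auto simp: iff free_module_simps(2-) K.is_cring K.l_distr K.r_distr K.m_assoc)
qed

lemma free_gen_carrier: "cring K \<Longrightarrow> x \<in> X \<Longrightarrow> free_gen K x \<in> carrier (free_module K X)"
proof -
  assume "cring K" "x \<in> X"
  interpret K: cring K by fact
  have "{y. free_gen K x y \<noteq> \<zero>\<^bsub>K\<^esub>} \<subseteq> {x}" by (auto simp: free_gen_def)
  then show ?thesis
    using \<open>x \<in> X\<close> by (auto simp: free_module_carrier_iff[OF \<open>cring K\<close>] free_gen_def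
        intro: finite_subset[of _ "{x}"])
qed

text \<open>Induction on a finite set \<open>A\<close> containing the support rather than on the
  support: clearing coordinate \<open>x\<close> leaves a vector supported in the smaller set whether
  or not that coordinate was already zero.\<close>

lemma lin_span_free_gen:
  assumes "cring K"
  shows "lin_span K (free_module K X) (free_gen K ` X) = carrier (free_module K X)"
proof -
  interpret K: cring K by fact
  interpret F: module K "free_module K X" by (rule module_free) fact
  note iff = free_module_carrier_iff[OF assms]
  show ?thesis
  proof (rule lin_span_eq_carrierI)
    show "free_gen K ` X \<subseteq> carrier (free_module K X)"
      using free_gen_carrier[OF assms] by auto
    fix H assume H: "submodule H K (free_module K X)" "free_gen K ` X \<subseteq> H"
    have "v \<in> H" if "finite A" "v \<in> carrier (free_module K X)" "{x. v x \<noteq> \<zero>\<^bsub>K\<^esub>} \<subseteq> A" for v A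
      using that
    proof (induction A arbitrary: v rule: finite_induct)
      case empty
      then have "v = \<zero>\<^bsub>free_module K X\<^esub>" by (auto simp: free_module_simps)
      then show ?case using submodule_zero_closed[OF H(1)] by simp
    next
      case (insert x A)
      define w where "w = v(x := \<zero>\<^bsub>K\<^esub>)"
      have "{y. w y \<noteq> \<zero>\<^bsub>K\<^esub>} \<subseteq> {y. v y \<noteq> \<zero>\<^bsub>K\<^esub>}" by (auto simp: w_def)
      then have w: "w \<in> carrier (free_module K X)"
        using insert.prems(1) by (auto simp: iff w_def intro: finite_subset)
      have "w \<in> H"
        by (rule insert.IH[OF w]) (use insert.prems in \<open>auto simp: w_def\<close>)
      show ?case
      proof (cases "v x = \<zero>\<^bsub>K\<^esub>")
        case True
        then have "w = v" by (auto simp: w_def)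
        with \<open>w \<in> H\<close> show ?thesis by simp
      next
        case False
        then have "x \<in> X" using insert.prems by (auto simp: iff)
        have vx: "\<And>y. v y \<in> carrier K" using insert.prems by (auto simp: iff)
        have "v = w \<oplus>\<^bsub>free_module K X\<^esub> (v x \<odot>\<^bsub>free_module K X\<^esub> free_gen K x)"
          using vx by (auto simp: w_def free_module_simps free_gen_def)
        moreover have "v x \<odot>\<^bsub>free_module K X\<^esub> free_gen K x \<in> H"
          using F.submoduleE(4)[OF H(1)] vx H(2) \<open>x \<in> X\<close> by auto
        ultimately show ?thesis
          using F.submoduleE(5)[OF H(1) \<open>w \<in> H\<close>] by metis
      qed
    qed
    then show "carrier (free_module K X) \<subseteq> H"
      by (auto simp: iff)
  qed (rule module_free[OF assms])
qed

lemma free_lift: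
  fixes K :: "('k, 'c) ring_scheme" and X :: "'x set"
  assumes "module K N" "\<And>x. x \<in> X \<Longrightarrow> f x \<in> carrier N"
  shows "\<exists>h\<in>lin_hom K (free_module K X) N. \<forall>x\<in>X. h (free_gen K x) = f x"
proof -
  interpret N: module K N by fact
  note iff = free_module_carrier_iff[OF N.is_cring]
  define supp where "supp v = {x. v x \<noteq> \<zero>\<^bsub>K\<^esub>}" for v :: "'x \<Rightarrow> 'k"
  define h where "h v = (\<Oplus>\<^bsub>N\<^esub>x\<in>supp v. v x \<odot>\<^bsub>N\<^esub> f x)" for v
  \<comment> \<open>Supports can shrink through cancellation when vectors are added or scaled.
    Linearity is therefore checked after rewriting all sums over a common finite set that contains
    the supports involved.\<close>
  have h_eq: "h v = (\<Oplus>\<^bsub>N\<^esub>x\<in>A. v x \<odot>\<^bsub>N\<^esub> f x)"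
    if "v \<in> carrier (free_module K X)" "finite A" "supp v \<subseteq> A" "A \<subseteq> X" for v A
    unfolding h_def
    by (rule N.add.finprod_mono_neutral_cong_left)
      (use that assms(2) in \<open>auto simp: iff supp_def Pi_def\<close>)
  interpret F: module K "free_module K X" by (rule module_free) (rule N.is_cring)
  have "h \<in> lin_hom K (free_module K X) N"
  proof (rule lin_homI)
    fix v assume v: "v \<in> carrier (free_module K X)"
    have sv: "finite (supp v)" "supp v \<subseteq> X" using v by (auto simp: iff supp_def)
    show "h v \<in> carrier N" unfolding h_def
      by (rule N.finsum_closed) (use sv v assms(2) in \<open>auto simp: iff\<close>)
    {
      fix w assume w: "w \<in> carrier (free_module K X)"
      have sw: "finite (supp w)" "supp w \<subseteq> X" using w by (auto simp: iff supp_def)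
      let ?A = "supp v \<union> supp w"
      have fA: "f x \<in> carrier N" if "x \<in> ?A" for x using assms(2) that sv sw by auto
      have "h (v \<oplus>\<^bsub>free_module K X\<^esub> w) =
          (\<Oplus>\<^bsub>N\<^esub>x\<in>?A. (v \<oplus>\<^bsub>free_module K X\<^esub> w) x \<odot>\<^bsub>N\<^esub> f x)"
        by (rule h_eq[OF F.a_closed[OF v w]])
          (use sv sw v w in \<open>auto simp: supp_def free_module_simps(3)\<close>)
      also have "\<dots> = (\<Oplus>\<^bsub>N\<^esub>x\<in>?A. v x \<odot>\<^bsub>N\<^esub> f x \<oplus>\<^bsub>N\<^esub> w x \<odot>\<^bsub>N\<^esub> f x)"
        by (rule N.finsum_cong')
          (use v w fA in \<open>auto simp: iff free_module_simps(3) N.smult_l_distr\<close>)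
      also have "\<dots> = (\<Oplus>\<^bsub>N\<^esub>x\<in>?A. v x \<odot>\<^bsub>N\<^esub> f x) \<oplus>\<^bsub>N\<^esub> (\<Oplus>\<^bsub>N\<^esub>x\<in>?A. w x \<odot>\<^bsub>N\<^esub> f x)"
        by (rule N.finsum_addf) (use v w fA in \<open>auto simp: iff\<close>)
      also have "\<dots> = h v \<oplus>\<^bsub>N\<^esub> h w"
        using h_eq[OF v, of ?A] h_eq[OF w, of ?A] sv sw by simp
      finally show "h (v \<oplus>\<^bsub>free_module K X\<^esub> w) = h v \<oplus>\<^bsub>N\<^esub> h w" .
    }
    {
      fix a assume a: "a \<in> carrier K"
      have fA: "f x \<in> carrier N" if "x \<in> supp v" for x using assms(2) that sv by auto
      have "h (a \<odot>\<^bsub>free_module K X\<^esub> v) =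
          (\<Oplus>\<^bsub>N\<^esub>x\<in>supp v. (a \<odot>\<^bsub>free_module K X\<^esub> v) x \<odot>\<^bsub>N\<^esub> f x)"
        by (rule h_eq[OF F.smult_closed[OF a v]])
          (use sv v a in \<open>auto simp: supp_def free_module_simps(4)\<close>)
      also have "\<dots> = (\<Oplus>\<^bsub>N\<^esub>x\<in>supp v. a \<odot>\<^bsub>N\<^esub> (v x \<odot>\<^bsub>N\<^esub> f x))"
        by (rule N.finsum_cong')
          (use v a fA in \<open>auto simp: iff free_module_simps(4) N.smult_assoc1\<close>)
      also have "\<dots> = a \<odot>\<^bsub>N\<^esub> h v" unfolding h_def
        by (rule N.finsum_smult_ldistr[symmetric]) (use v a fA sv in \<open>auto simp: iff\<close>)
      finally show "h (a \<odot>\<^bsub>free_module K X\<^esub> v) = a \<odot>\<^bsub>N\<^esub> h v" .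
    }
  qed
  moreover have "h (free_gen K x) = f x" if x: "x \<in> X" for x
  proof -
    have "h (free_gen K x) = (\<Oplus>\<^bsub>N\<^esub>y\<in>{x}. free_gen K x y \<odot>\<^bsub>N\<^esub> f y)"
      by (rule h_eq) (use x free_gen_carrier[OF N.is_cring] in \<open>auto simp: supp_def free_gen_def\<close>)
    also have "\<dots> = f x"
      using assms(2)[OF x] by (simp add: free_gen_def)
    finally show ?thesis .
  qed
  ultimately show ?thesis by blast
qed

section \<open>Multilinear maps\<close>

lemma tuples_update: "xs \<in> tuples n S \<Longrightarrow> x \<in> S \<Longrightarrow> xs[i := x] \<in> tuples n S"
  by (auto simp: tuples_def dest: set_update_subset_insert[THEN subsetD])

lemma tuples_nth: "xs \<in> tuples n S \<Longrightarrow> i < n \<Longrightarrow> xs ! i \<in> S"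
  by (auto simp: tuples_def)

lemma tuples_length: "xs \<in> tuples n S \<Longrightarrow> length xs = n"
  by (auto simp: tuples_def)

lemma tuples_Cons: "x # xs \<in> tuples n S \<longleftrightarrow> x \<in> S \<and> xs \<in> tuples (n - 1) S \<and> n > 0"
  by (auto simp: tuples_def)

lemma tuples_take: "xs \<in> tuples n S \<Longrightarrow> m \<le> n \<Longrightarrow> take m xs \<in> tuples m S"
  by (auto simp: tuples_def dest: in_set_takeD)

lemma tuples_drop: "xs \<in> tuples n S \<Longrightarrow> drop m xs \<in> tuples (n - m) S"
  by (auto simp: tuples_def dest: in_set_dropD)

lemma tuples_map: "(\<And>x. x \<in> S \<Longrightarrow> f x \<in> T) \<Longrightarrow> xs \<in> tuples n S \<Longrightarrow> map f xs \<in> tuples n T"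
  by (auto simp: tuples_def)

text \<open>Entrywise choice of preimages. It presents a tuple of generators as the image of a tuple
  of argument lists, and later lifts tuples over L along the surjection from the p-fold tensor
  power.\<close>

lemma tuples_image: "tuples n (f ` S) = map f ` tuples n S"
proof -
  have "tuples n (f ` S) \<subseteq> map f ` tuples n S"
  proof
    fix ys assume "ys \<in> tuples n (f ` S)"
    then have *: "set ys \<subseteq> f ` S" "length ys = n" by (auto simp: tuples_def)
    then have "map (inv_into S f) ys \<in> tuples n S"
      by (auto simp: tuples_def inv_into_into)
    moreover have "ys = map f (map (inv_into S f) ys)"
      using * by (auto simp: f_inv_into_f intro!: map_idI[symmetric])
    ultimately show "ys \<in> map f ` tuples n S" by blast
  qed
  moreover have "map f ` tuples n S \<subseteq> tuples n (f ` S)"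
  proof
    fix ys assume "ys \<in> map f ` tuples n S"
    then obtain xs where "set xs \<subseteq> S" "length xs = n" "ys = map f xs" by (auto simp: tuples_def)
    then show "ys \<in> tuples n (f ` S)" by (simp add: tuples_def image_mono)
  qed
  ultimately show ?thesis by (rule equalityI)
qed

text \<open>Together with \<open>multilinear_slot\<close>, this trades multilinearity for linearity
  in each slot, so that closure properties of multilinear maps follow from those of
  \<open>lin_hom\<close>.\<close>

lemma multilinearI:
  assumes "module K M" "\<And>xs. xs \<in> tuples n (carrier M) \<Longrightarrow> f xs \<in> carrier N"
    and "\<And>xs i. xs \<in> tuples n (carrier M) \<Longrightarrow> i < n \<Longrightarrow> (\<lambda>x. f (xs[i := x])) \<in> lin_hom K M N"
  shows "multilinear K n M N f"
  unfolding multilinear_def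
  using assms(2) lin_hom_add[OF assms(3)] lin_hom_smult[OF assms(3)] by blast

lemma multilinear_closed:
  "multilinear K n M N f \<Longrightarrow> xs \<in> tuples n (carrier M) \<Longrightarrow> f xs \<in> carrier N"
  by (auto simp: multilinear_def)

lemma multilinear_slot:
  assumes "multilinear K n M N f" "xs \<in> tuples n (carrier M)" "i < n"
  shows "(\<lambda>x. f (xs[i := x])) \<in> lin_hom K M N"
  by (rule lin_homI)
    (use assms multilinear_closed[OF assms(1) tuples_update[OF assms(2)]] in
      \<open>auto simp: multilinear_def\<close>)

lemma multilinear_lin_comp:
  assumes "module K M" "multilinear K n M N f" "g \<in> lin_hom K N P"
  shows "multilinear K n M P (\<lambda>xs. g (f xs))"
  by (intro multilinearI[OF assms(1)] lin_hom_comp[OF multilinear_slot[OF assms(2)] assms(3)]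
      lin_hom_closed[OF assms(3)] multilinear_closed[OF assms(2)])

lemma multilinear_comp_map:
  assumes "module K M" "g \<in> lin_hom K M P" "multilinear K n P N f"
  shows "multilinear K n M N (\<lambda>xs. f (map g xs))"
proof (rule multilinearI[OF assms(1)])
  fix xs assume "xs \<in> tuples n (carrier M)"
  then have *: "map g xs \<in> tuples n (carrier P)"
    by (intro tuples_map) (auto intro: lin_hom_closed[OF assms(2)])
  then show "f (map g xs) \<in> carrier N" by (rule multilinear_closed[OF assms(3)])
  fix i assume "i < n"
  from lin_hom_comp[OF assms(2) multilinear_slot[OF assms(3) * this]]
  show "(\<lambda>x. f (map g (xs[i := x]))) \<in> lin_hom K M N"
    by (simp add: map_update)
qed

lemma multilinear_diff:
  assumes "module K M" "module K N" "multilinear K n M N f" "multilinear K n M N g"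
  shows "multilinear K n M N (\<lambda>xs. f xs \<ominus>\<^bsub>N\<^esub> g xs)"
proof -
  interpret N: module K N by fact
  show ?thesis
    by (intro multilinearI[OF assms(1)] lin_hom_fun_diff[OF assms(2)] multilinear_slot[OF assms(3)]
        multilinear_slot[OF assms(4)] N.minus_closed multilinear_closed[OF assms(3)]
        multilinear_closed[OF assms(4)])
qed

lemma multilinear_finsum:
  assumes "module K M" "module K N" "finite I" "\<And>i. i \<in> I \<Longrightarrow> multilinear K n M N (f i)"
  shows "multilinear K n M N (\<lambda>xs. \<Oplus>\<^bsub>N\<^esub>i\<in>I. f i xs)"
proof -
  interpret N: module K N by fact
  show ?thesis
    by (intro multilinearI[OF assms(1)] lin_hom_fun_finsum[OF assms(2,3)] multilinear_slot[OF assms(4)]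
        N.finsum_closed) (auto intro: multilinear_closed[OF assms(4)])
qed

text \<open>Linearity in the slot that holds zero. Applied to \<open>star\<close> after
  \<open>nest_last\<close>, this is what makes the kernel of \<open>star_map\<close>
  central.\<close>

lemma multilinear_eq_zero:
  assumes "module K M" "module K N" "multilinear K n M N f" "xs \<in> tuples n (carrier M)"
    and "\<zero>\<^bsub>M\<^esub> \<in> set xs"
  shows "f xs = \<zero>\<^bsub>N\<^esub>"
proof -
  obtain i where i: "i < n" "xs ! i = \<zero>\<^bsub>M\<^esub>"
    using assms(4,5) by (auto simp: in_set_conv_nth tuples_def)
  have "f (xs[i := \<zero>\<^bsub>M\<^esub>]) = \<zero>\<^bsub>N\<^esub>"
    by (rule lin_hom_zero[OF assms(1,2) multilinear_slot[OF assms(3,4) i(1)]])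
  then show ?thesis using i by (metis list_update_id)
qed

lemma multilinear_eq_on_span:
  assumes "module K M" "module K N" "multilinear K n M N f" "multilinear K n M N g"
    and span: "lin_span K M S = carrier M"
    and eq: "\<And>xs. xs \<in> tuples n S \<Longrightarrow> f xs = g xs"
    and xs: "xs \<in> tuples n (carrier M)"
  shows "f xs = g xs"
proof -
  \<comment> \<open>The entries from position \<open>m\<close> on lie in \<open>S\<close>, the
    earlier ones are arbitrary. For \<open>m = 0\<close> this is the hypothesis \<open>eq\<close>;
    each step frees one more entry by linearity in its slot, and \<open>m = n\<close> is the
    claim.\<close>
  have "f xs = g xs" if "xs \<in> tuples n (carrier M)" "m \<le> n" "\<forall>i. m \<le> i \<and> i < n \<longrightarrow> xs ! i \<in> S" for m xs
    using that
  proof (induction m arbitrary: xs)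
    case 0
    then have "xs \<in> tuples n S" by (auto simp: tuples_def in_set_conv_nth)
    then show ?case by (rule eq)
  next
    case (Suc m)
    then have m: "m < n" by simp
    have "f (xs[m := x]) = g (xs[m := x])" if x: "x \<in> S" for x
    proof (rule Suc.IH)
      show "xs[m := x] \<in> tuples n (carrier M)"
        using Suc.prems(1) x span lin_span_superset[of S K M] by (auto intro: tuples_update)
      show "\<forall>i. m \<le> i \<and> i < n \<longrightarrow> xs[m := x] ! i \<in> S"
        using Suc.prems x tuples_length[OF Suc.prems(1)] by (auto simp: nth_list_update)
    qed (use m in simp)
    then have "f (xs[m := xs ! m]) = g (xs[m := xs ! m])"
      by (rule lin_hom_eq_on_span[OF assms(1,2) multilinear_slot[OF assms(3) Suc.prems(1) m]
            multilinear_slot[OF assms(4) Suc.prems(1) m] span])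
        (use tuples_nth[OF Suc.prems(1) m] in auto)
    then show ?case by simp
  qed
  from this[OF xs le_refl] show ?thesis by (meson leD)
qed

section \<open>Tensor powers\<close>

lemma (in abelian_group) eq_of_minus_eq_zero:
  assumes "a \<ominus> b = \<zero>" "a \<in> carrier G" "b \<in> carrier G"
  shows "a = b"
proof -
  have "a = (a \<ominus> b) \<oplus> b" using assms(2,3) by (simp add: minus_eq a_assoc l_neg)
  then show ?thesis using assms by simp
qed

lemma submodule_tensor_rels:
  assumes "module K M" shows "submodule (tensor_rels K n M) K (free_tuples K n M)"
proof -
  interpret M: module K M by fact
  interpret F: module K "free_tuples K n M" by (rule module_free[OF M.is_cring])
  have g: "free_gen K xs \<in> carrier (free_tuples K n M)" if "xs \<in> tuples n (carrier M)" for xs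
    using that by (rule free_gen_carrier[OF M.is_cring])
  show ?thesis
    unfolding tensor_rels_def
    by (rule submodule_lin_span[OF F.module_axioms])
      (auto intro!: F.minus_closed F.add.m_closed F.smult_closed g tuples_update)
qed

lemma module_tensor_power:
  assumes "module K M" shows "module K (tensor_power K n M)"
  unfolding tensor_power_def
  by (intro module_quot module_free submodule_tensor_rels assms module.axioms(1)[OF assms])

lemma lin_span_pure_tensor:
  assumes "module K M"
  shows "lin_span K (tensor_power K n M) (pure_tensor K n M ` tuples n (carrier M)) =
    carrier (tensor_power K n M)"
proof -
  interpret M: module K M by fact
  note F = module_free[OF M.is_cring, of "tuples n (carrier M)"]
    and H = submodule_tensor_rels[OF assms, of n]
  have "lin_span K (tensor_power K n M) ((\<lambda>x. tensor_rels K n M +>\<^bsub>free_tuples K n M\<^esub> x) `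
      free_gen K ` tuples n (carrier M)) = carrier (tensor_power K n M)"
    unfolding tensor_power_def
    by (rule lin_span_surj_image[OF F module_quot[OF F H] quot_map_lin_hom[OF F H]
          quot_carrier[symmetric] lin_span_free_gen[OF M.is_cring]])
  then show ?thesis
    by (simp add: image_image pure_tensor_def)
qed

lemma pure_tensor_multilinear:
  assumes "module K M"
  shows "multilinear K n M (tensor_power K n M) (pure_tensor K n M)"
proof -
  interpret M: module K M by fact
  let ?F = "free_tuples K n M" and ?H = "tensor_rels K n M"
  interpret F: module K ?F by (rule module_free[OF M.is_cring])
  interpret T: module K "tensor_power K n M" by (rule module_tensor_power[OF assms])
  note H = submodule_tensor_rels[OF assms, of n]
  define q where "q = (\<lambda>x. ?H +>\<^bsub>?F\<^esub> x)"
  have q: "q \<in> lin_hom K ?F (tensor_power K n M)"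
    unfolding tensor_power_def q_def by (rule quot_map_lin_hom[OF F.module_axioms H])
  have g: "free_gen K xs \<in> carrier ?F" if "xs \<in> tuples n (carrier M)" for xs
    using that by (rule free_gen_carrier[OF M.is_cring])
  \<comment> \<open>The relations are imposed as differences, so an identity between classes comes
    from a difference of representatives that is itself a relation.\<close>
  have qeq: "q u = q v" if "u \<ominus>\<^bsub>?F\<^esub> v \<in> ?H" "u \<in> carrier ?F" "v \<in> carrier ?F" for u v
  proof -
    have "q (u \<ominus>\<^bsub>?F\<^esub> v) = \<zero>\<^bsub>tensor_power K n M\<^esub>"
      unfolding q_def tensor_power_def by (rule quot_map_eq_zero[OF F.module_axioms H that(1)])
    then have "q u \<ominus>\<^bsub>tensor_power K n M\<^esub> q v = \<zero>\<^bsub>tensor_power K n M\<^esub>"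
      by (simp only: lin_hom_diff[OF F.module_axioms T.module_axioms q that(2,3)])
    then show ?thesis
      by (rule T.eq_of_minus_eq_zero) (intro lin_hom_closed[OF q] that(2,3))+
  qed
  have pure: "pure_tensor K n M xs = q (free_gen K xs)" for xs
    by (simp add: q_def pure_tensor_def)
  show ?thesis
    unfolding multilinear_def pure
  proof (intro conjI ballI allI impI Pi_I)
    fix xs assume xs: "xs \<in> tuples n (carrier M)"
    show "q (free_gen K xs) \<in> carrier (tensor_power K n M)"
      by (rule lin_hom_closed[OF q g[OF xs]])
    fix i assume i: "i < n"
    have gi: "free_gen K (xs[i := x]) \<in> carrier ?F" if "x \<in> carrier M" for x
      using that xs by (intro g tuples_update)
    {
      fix x y assume x: "x \<in> carrier M" and y: "y \<in> carrier M"
      have "q (free_gen K (xs[i := x \<oplus>\<^bsub>M\<^esub> y])) =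
          q (free_gen K (xs[i := x]) \<oplus>\<^bsub>?F\<^esub> free_gen K (xs[i := y]))"
      proof (rule qeq)
        show "free_gen K (xs[i := x \<oplus>\<^bsub>M\<^esub> y]) \<ominus>\<^bsub>?F\<^esub>
            (free_gen K (xs[i := x]) \<oplus>\<^bsub>?F\<^esub> free_gen K (xs[i := y])) \<in> ?H"
          unfolding tensor_rels_def
          by (rule subsetD[OF lin_span_superset], rule UnI1, rule CollectI, intro exI conjI, rule refl)
            (use xs i x y in auto)
      qed (use gi x y in auto)
      then show "q (free_gen K (xs[i := x \<oplus>\<^bsub>M\<^esub> y])) = q (free_gen K (xs[i := x]))
          \<oplus>\<^bsub>tensor_power K n M\<^esub> q (free_gen K (xs[i := y]))"
        using gi x y by (simp add: lin_hom_add[OF q])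
    }
    {
      fix a x assume a: "a \<in> carrier K" and x: "x \<in> carrier M"
      have "q (free_gen K (xs[i := a \<odot>\<^bsub>M\<^esub> x])) = q (a \<odot>\<^bsub>?F\<^esub> free_gen K (xs[i := x]))"
      proof (rule qeq)
        show "free_gen K (xs[i := a \<odot>\<^bsub>M\<^esub> x]) \<ominus>\<^bsub>?F\<^esub> (a \<odot>\<^bsub>?F\<^esub> free_gen K (xs[i := x])) \<in> ?H"
          unfolding tensor_rels_def
          by (rule subsetD[OF lin_span_superset], rule UnI2, rule CollectI, intro exI conjI, rule refl)
            (use xs i a x in auto)
      qed (use gi a x in auto)
      then show "q (free_gen K (xs[i := a \<odot>\<^bsub>M\<^esub> x])) =
          a \<odot>\<^bsub>tensor_power K n M\<^esub> q (free_gen K (xs[i := x]))"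
        using gi a x by (simp add: lin_hom_smult[OF q])
    }
  qed
qed

text \<open>The kernel of the extension of \<open>f\<close> to the free module is a submodule, so it
  contains all relations once it contains the generating ones, and on those vanishing is exactly the
  multilinearity of \<open>f\<close>.\<close>

lemma tensor_lift:
  assumes "module K M" "module K N" "multilinear K n M N f"
  shows "\<exists>h\<in>lin_hom K (tensor_power K n M) N.
    \<forall>xs\<in>tuples n (carrier M). h (pure_tensor K n M xs) = f xs"
proof -
  interpret M: module K M by fact
  interpret N: module K N by fact
  let ?F = "free_tuples K n M" and ?H = "tensor_rels K n M"
  interpret F: module K ?F by (rule module_free[OF M.is_cring])
  note H = submodule_tensor_rels[OF assms(1), of n]
  have g: "free_gen K xs \<in> carrier ?F" if "xs \<in> tuples n (carrier M)" for xs
    using that by (rule free_gen_carrier[OF M.is_cring])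
  obtain h where h: "h \<in> lin_hom K ?F N" "\<And>xs. xs \<in> tuples n (carrier M) \<Longrightarrow> h (free_gen K xs) = f xs"
    using free_lift[OF assms(2), of "tuples n (carrier M)" f, OF multilinear_closed[OF assms(3)]]
    by blast
  \<comment> \<open>The kernel is written as the preimage of the zero submodule so that
    \<open>submodule_vimage\<close> applies to it.\<close>
  have "?H \<subseteq> {v \<in> carrier ?F. h v \<in> {\<zero>\<^bsub>N\<^esub>}}"
    unfolding tensor_rels_def
  proof (rule lin_span_least[OF submodule_vimage[OF F.module_axioms assms(2) h(1)
        submodule_singleton_zero[OF assms(2)]]])
    have fc: "f (xs[i := x]) \<in> carrier N"
      if "xs \<in> tuples n (carrier M)" "x \<in> carrier M" for xs i x
      using that by (intro multilinear_closed[OF assms(3)] tuples_update)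
    have add: "f (xs[i := x \<oplus>\<^bsub>M\<^esub> y]) = f (xs[i := x]) \<oplus>\<^bsub>N\<^esub> f (xs[i := y])"
      if "xs \<in> tuples n (carrier M)" "i < n" "x \<in> carrier M" "y \<in> carrier M" for xs i x y
      using assms(3) that by (auto simp: multilinear_def)
    have smult: "f (xs[i := a \<odot>\<^bsub>M\<^esub> x]) = a \<odot>\<^bsub>N\<^esub> f (xs[i := x])"
      if "xs \<in> tuples n (carrier M)" "i < n" "a \<in> carrier K" "x \<in> carrier M" for xs i a x
      using assms(3) that by (auto simp: multilinear_def)
    show "{free_gen K (xs[i := x \<oplus>\<^bsub>M\<^esub> y]) \<ominus>\<^bsub>?F\<^esub>
         (free_gen K (xs[i := x]) \<oplus>\<^bsub>?F\<^esub> free_gen K (xs[i := y])) | xs i x y.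
        xs \<in> tuples n (carrier M) \<and> i < n \<and> x \<in> carrier M \<and> y \<in> carrier M} \<union>
      {free_gen K (xs[i := a \<odot>\<^bsub>M\<^esub> x]) \<ominus>\<^bsub>?F\<^esub>
         (a \<odot>\<^bsub>?F\<^esub> free_gen K (xs[i := x])) | xs i a x.
        xs \<in> tuples n (carrier M) \<and> i < n \<and> a \<in> carrier K \<and> x \<in> carrier M}
      \<subseteq> {v \<in> carrier ?F. h v \<in> {\<zero>\<^bsub>N\<^esub>}}"
    proof (rule Un_least)
      have zero: "u \<ominus>\<^bsub>?F\<^esub> v \<in> {v \<in> carrier ?F. h v \<in> {\<zero>\<^bsub>N\<^esub>}}"
        if "u \<in> carrier ?F" "v \<in> carrier ?F" "h u = h v" for u v
      proof -
        have "h (u \<ominus>\<^bsub>?F\<^esub> v) = \<zero>\<^bsub>N\<^esub>"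
          unfolding lin_hom_diff[OF F.module_axioms assms(2) h(1) that(1,2)] that(3)
          using lin_hom_closed[OF h(1) that(2)] by (simp add: N.minus_eq N.r_neg)
        then show ?thesis using that(1,2) F.minus_closed by blast
      qed
      have gi: "free_gen K (xs[i := x]) \<in> carrier ?F"
        if "xs \<in> tuples n (carrier M)" "x \<in> carrier M" for xs i x
        using that by (intro g tuples_update)
      have hi: "h (free_gen K (xs[i := x])) = f (xs[i := x])"
        if "xs \<in> tuples n (carrier M)" "x \<in> carrier M" for xs i x
        using that by (intro h(2) tuples_update)
      show "{free_gen K (xs[i := x \<oplus>\<^bsub>M\<^esub> y]) \<ominus>\<^bsub>?F\<^esub>
           (free_gen K (xs[i := x]) \<oplus>\<^bsub>?F\<^esub> free_gen K (xs[i := y])) | xs i x y.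
          xs \<in> tuples n (carrier M) \<and> i < n \<and> x \<in> carrier M \<and> y \<in> carrier M}
        \<subseteq> {v \<in> carrier ?F. h v \<in> {\<zero>\<^bsub>N\<^esub>}}"
        by (rule subsetI, elim CollectE exE conjE, hypsubst, rule zero)
          (simp_all add: gi hi lin_hom_add[OF h(1)] add)
      show "{free_gen K (xs[i := a \<odot>\<^bsub>M\<^esub> x]) \<ominus>\<^bsub>?F\<^esub>
           (a \<odot>\<^bsub>?F\<^esub> free_gen K (xs[i := x])) | xs i a x.
          xs \<in> tuples n (carrier M) \<and> i < n \<and> a \<in> carrier K \<and> x \<in> carrier M}
        \<subseteq> {v \<in> carrier ?F. h v \<in> {\<zero>\<^bsub>N\<^esub>}}"
        by (rule subsetI, elim CollectE exE conjE, hypsubst, rule zero)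
          (simp_all add: gi hi lin_hom_smult[OF h(1)] smult)
    qed
  qed
  then have "\<exists>h'\<in>lin_hom K (quot_module ?F ?H) N. \<forall>x\<in>carrier ?F. h' (?H +>\<^bsub>?F\<^esub> x) = h x"
    by (intro quot_lift[OF F.module_axioms H assms(2) h(1)]) blast
  then obtain h' where "h' \<in> lin_hom K (tensor_power K n M) N"
    and "\<And>x. x \<in> carrier ?F \<Longrightarrow> h' (?H +>\<^bsub>?F\<^esub> x) = h x"
    unfolding tensor_power_def by blast
  then show ?thesis
    using g h(2) by (intro bexI[of _ h']) (auto simp: pure_tensor_def)
qed

section \<open>Non-abelian tensor powers\<close>

text \<open>Covers the first term of \<open>delta2\<close>, whose multilinearity
  \<open>tensor_lift\<close> requires. A slot below \<open>n\<close> lies inside the inner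
  operation; a later slot \<open>j\<close> becomes slot \<open>Suc (j - n)\<close> of the outer one,
  the shift being due to the entry placed in front.\<close>

lemma multilinear_nest_first:
  assumes "module K M" "n > 0" "multilinear K n M M b" "multilinear K n M N f"
  shows "multilinear K (2 * n - 1) M N (\<lambda>zs. f (b (take n zs) # drop n zs))"
proof (rule multilinearI[OF assms(1)])
  fix zs assume zs: "zs \<in> tuples (2 * n - 1) (carrier M)"
  have t: "take n zs \<in> tuples n (carrier M)"
    by (rule tuples_take[OF zs]) (use assms(2) in simp)
  have d: "drop n zs \<in> tuples (n - 1) (carrier M)"
    using tuples_drop[OF zs, of n] assms(2) by simp
  have bt: "b (take n zs) # drop n zs \<in> tuples n (carrier M)"
    using assms(2) d multilinear_closed[OF assms(3) t] by (simp add: tuples_Cons)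
  then show "f (b (take n zs) # drop n zs) \<in> carrier N"
    by (rule multilinear_closed[OF assms(4)])
  fix j assume j: "j < 2 * n - 1"
  show "(\<lambda>x. f (b (take n (zs[j := x])) # drop n (zs[j := x]))) \<in> lin_hom K M N"
  proof (cases "j < n")
    case True
    from lin_hom_comp[OF multilinear_slot[OF assms(3) t True] multilinear_slot[OF assms(4) bt assms(2)]]
    show ?thesis using True by (simp add: take_update_swap)
  next
    case False
    then have "Suc (j - n) < n" using j by simp
    from multilinear_slot[OF assms(4) bt this]
    show ?thesis using False by (simp add: drop_update_swap)
  qed
qed

text \<open>Covers the \<open>i\<close>-th summand of \<open>delta2\<close>. Varying entry
  \<open>j\<close> acts on the head of the inner operation if \<open>j = i\<close>, on an outer slot
  for any other \<open>j < n\<close>, and on slot \<open>Suc (j - n)\<close> of the inner operation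
  otherwise.\<close>

lemma multilinear_nest_at:
  assumes "module K M" "i < n" "multilinear K n M M b" "multilinear K n M N f"
  shows "multilinear K (2 * n - 1) M N (\<lambda>zs. f ((take n zs)[i := b (take n zs ! i # drop n zs)]))"
proof (rule multilinearI[OF assms(1)])
  have n: "n > 0" using assms(2) by simp
  fix zs assume zs: "zs \<in> tuples (2 * n - 1) (carrier M)"
  have t: "take n zs \<in> tuples n (carrier M)"
    by (rule tuples_take[OF zs]) (use n in simp)
  have d: "drop n zs \<in> tuples (n - 1) (carrier M)"
    using tuples_drop[OF zs, of n] n by simp
  have td: "take n zs ! i # drop n zs \<in> tuples n (carrier M)"
    using n d tuples_nth[OF t assms(2)] by (simp add: tuples_Cons)
  note btd = multilinear_closed[OF assms(3) td]
  have u: "(take n zs)[i := b (take n zs ! i # drop n zs)] \<in> tuples n (carrier M)"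
    by (rule tuples_update[OF t btd])
  then show "f ((take n zs)[i := b (take n zs ! i # drop n zs)]) \<in> carrier N"
    by (rule multilinear_closed[OF assms(4)])
  fix j assume j: "j < 2 * n - 1"
  show "(\<lambda>x. f ((take n (zs[j := x]))[i := b (take n (zs[j := x]) ! i # drop n (zs[j := x]))]))
    \<in> lin_hom K M N"
  proof (cases "j < n")
    case True
    show ?thesis
    proof (cases "j = i")
      case True
      from lin_hom_comp[OF multilinear_slot[OF assms(3) td n] multilinear_slot[OF assms(4) t assms(2)]]
      show ?thesis
        using True assms(2) tuples_length[OF t] by (simp add: take_update_swap del: length_take)
    next
      case False
      from multilinear_slot[OF assms(4) u \<open>j < n\<close>]
      show ?thesis
        using False \<open>j < n\<close> by (simp add: take_update_swap list_update_swap[of j i])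
    qed
  next
    case False
    then have "Suc (j - n) < n" using j by simp
    from lin_hom_comp[OF multilinear_slot[OF assms(3) td this] multilinear_slot[OF assms(4) t assms(2)]]
    show ?thesis using False by (simp add: drop_update_swap)
  qed
qed

text \<open>The target \<open>N\<close> is arbitrary, so that the condition can be imposed on the
  bracket, on \<open>star\<close>, and on any map that is to be factored through the tensor
  power.\<close>

definition leibniz_balanced ::
  "nat \<Rightarrow> ('k, 'a, 'm) leibniz_scheme \<Rightarrow> ('k, 'b, 'l) module_scheme \<Rightarrow> ('a list \<Rightarrow> 'b) \<Rightarrow> bool" where
  "leibniz_balanced n L N f \<longleftrightarrow>
    (\<forall>xs\<in>tuples n (carrier L). \<forall>ys\<in>tuples (n - 1) (carrier L).
      f (bracket L xs # ys) = (\<Oplus>\<^bsub>N\<^esub>i\<in>{..<n}. f (xs[i := bracket L (xs ! i # ys)])))"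

text \<open>The formula behind \<open>delta2\<close> with the pure tensor replaced by any
  \<open>f\<close>. It reads a single list of length \<open>2 * n - 1\<close> because it has to be
  multilinear on that power.\<close>

definition leibniz_defect ::
  "nat \<Rightarrow> ('k, 'a, 'm) leibniz_scheme \<Rightarrow> ('k, 'b, 'l) module_scheme \<Rightarrow> ('a list \<Rightarrow> 'b) \<Rightarrow> 'a list \<Rightarrow> 'b" where
  "leibniz_defect n L N f zs = (let xs = take n zs; ys = drop n zs in
     f (bracket L xs # ys) \<ominus>\<^bsub>N\<^esub> (\<Oplus>\<^bsub>N\<^esub>i\<in>{..<n}. f (xs[i := bracket L (xs ! i # ys)])))"

text \<open>For \<open>n = 0\<close> the truncated \<open>n - 1\<close> would turn an element
  followed by \<open>n - 1\<close> further ones into a list of length 1 instead of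
  \<open>n\<close>.\<close>

locale leibniz_algebra_pos = leibniz_algebra +
  assumes n_pos: "n > 0"
begin

lemma mod_L: "module K L" ..

lemma split_tuple:
  assumes "zs \<in> tuples (2 * n - 1) (carrier L)"
  shows "take n zs \<in> tuples n (carrier L)" "drop n zs \<in> tuples (n - 1) (carrier L)"
  using tuples_take[OF assms, of n] tuples_drop[OF assms, of n] n_pos by auto

lemma append_tuple:
  assumes "xs \<in> tuples n (carrier L)" "ys \<in> tuples (n - 1) (carrier L)"
  shows "xs @ ys \<in> tuples (2 * n - 1) (carrier L)"
  using assms n_pos by (auto simp: tuples_def)

lemma bracket_closed: "xs \<in> tuples n (carrier L) \<Longrightarrow> bracket L xs \<in> carrier L"
  by (rule multilinear_closed[OF bracket_multilinear])

lemma bracket_Cons_closed: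
  "x \<in> carrier L \<Longrightarrow> ys \<in> tuples (n - 1) (carrier L) \<Longrightarrow> bracket L (x # ys) \<in> carrier L"
  using n_pos by (intro bracket_closed) (simp add: tuples_Cons)

lemma tuples_bracket_Cons:
  "xs \<in> tuples n (carrier L) \<Longrightarrow> ys \<in> tuples (n - 1) (carrier L) \<Longrightarrow>
    bracket L xs # ys \<in> tuples n (carrier L)"
  using n_pos bracket_closed by (simp add: tuples_Cons)

lemma tuples_bracket_at:
  "xs \<in> tuples n (carrier L) \<Longrightarrow> ys \<in> tuples (n - 1) (carrier L) \<Longrightarrow> i < n \<Longrightarrow>
    xs[i := bracket L (xs ! i # ys)] \<in> tuples n (carrier L)"
  by (intro tuples_update bracket_Cons_closed tuples_nth)

lemma leibniz_defect_multilinear: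
  assumes "module K N" "multilinear K n L N f"
  shows "multilinear K (2 * n - 1) L N (leibniz_defect n L N f)"
proof -
  have "multilinear K (2 * n - 1) L N (\<lambda>zs. f (bracket L (take n zs) # drop n zs) \<ominus>\<^bsub>N\<^esub>
      (\<Oplus>\<^bsub>N\<^esub>i\<in>{..<n}. f ((take n zs)[i := bracket L (take n zs ! i # drop n zs)])))"
    by (intro multilinear_diff[OF mod_L assms(1)] multilinear_finsum[OF mod_L assms(1)]
        multilinear_nest_first[OF mod_L n_pos bracket_multilinear assms(2)]
        multilinear_nest_at[OF mod_L _ bracket_multilinear assms(2)]) auto
  moreover have "leibniz_defect n L N f = (\<lambda>zs. f (bracket L (take n zs) # drop n zs) \<ominus>\<^bsub>N\<^esub>
      (\<Oplus>\<^bsub>N\<^esub>i\<in>{..<n}. f ((take n zs)[i := bracket L (take n zs ! i # drop n zs)])))"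
    by (simp add: leibniz_defect_def Let_def fun_eq_iff)
  ultimately show ?thesis by simp
qed

lemma leibniz_defect_eq_zero:
  assumes "module K N" "multilinear K n L N f" "leibniz_balanced n L N f"
    and zs: "zs \<in> tuples (2 * n - 1) (carrier L)"
  shows "leibniz_defect n L N f zs = \<zero>\<^bsub>N\<^esub>"
proof -
  interpret N: module K N by fact
  note xy = split_tuple[OF zs]
  have "f (bracket L (take n zs) # drop n zs) \<in> carrier N"
    by (rule multilinear_closed[OF assms(2) tuples_bracket_Cons[OF xy]])
  moreover have "f (bracket L (take n zs) # drop n zs) =
      (\<Oplus>\<^bsub>N\<^esub>i\<in>{..<n}. f ((take n zs)[i := bracket L (take n zs ! i # drop n zs)]))"
    using assms(3) xy unfolding leibniz_balanced_def by blast
  ultimately show ?thesis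
    unfolding leibniz_defect_def Let_def by (simp add: N.minus_eq N.r_neg)
qed

text \<open>Naturality of the defect. It is used for the quotient map, to see that the relations
  hold in the cokernel, and for a lift to the tensor power, to see that it kills the range of
  \<open>delta2\<close>.\<close>

lemma lin_hom_leibniz_defect:
  assumes "module K N" "multilinear K n L N f" "module K P" "h \<in> lin_hom K N P"
    and zs: "zs \<in> tuples (2 * n - 1) (carrier L)"
  shows "h (leibniz_defect n L N f zs) = leibniz_defect n L P (\<lambda>xs. h (f xs)) zs"
proof -
  interpret N: module K N by fact
  note xy = split_tuple[OF zs]
  have 1: "f (bracket L (take n zs) # drop n zs) \<in> carrier N"
    by (rule multilinear_closed[OF assms(2) tuples_bracket_Cons[OF xy]])
  have 2: "(\<lambda>i. f ((take n zs)[i := bracket L (take n zs ! i # drop n zs)])) \<in> {..<n} \<rightarrow> carrier N"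
    by (auto intro!: multilinear_closed[OF assms(2)] tuples_bracket_at[OF xy])
  show ?thesis
    unfolding leibniz_defect_def Let_def
      lin_hom_diff[OF assms(1,3,4) 1 N.finsum_closed[OF 2]] lin_hom_finsum[OF assms(1,3,4) 2]
    by (rule refl)
qed

lemma leibniz_defect_cong:
  assumes "module K N" "\<And>xs. xs \<in> tuples n (carrier L) \<Longrightarrow> f xs = g xs" "multilinear K n L N g"
    and zs: "zs \<in> tuples (2 * n - 1) (carrier L)"
  shows "leibniz_defect n L N f zs = leibniz_defect n L N g zs"
proof -
  interpret N: module K N by fact
  note xy = split_tuple[OF zs]
  have "(\<Oplus>\<^bsub>N\<^esub>i\<in>{..<n}. f ((take n zs)[i := bracket L (take n zs ! i # drop n zs)])) =
      (\<Oplus>\<^bsub>N\<^esub>i\<in>{..<n}. g ((take n zs)[i := bracket L (take n zs ! i # drop n zs)]))"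
    by (rule N.finsum_cong'[OF refl])
      (auto simp del: nth_take intro!: multilinear_closed[OF assms(3)] assms(2) tuples_bracket_at[OF xy])
  then show ?thesis
    unfolding leibniz_defect_def Let_def assms(2)[OF tuples_bracket_Cons[OF xy]] by (rule arg_cong)
qed

section \<open>The relation map and the universal property of its cokernel\<close>

lemma mod_tensor: "module K (tensor_power K m L)"
  by (rule module_tensor_power[OF mod_L])

text \<open>The defect of the pure tensor map is multilinear, so a linear map with the prescribed
  values exists and the description of \<open>delta2\<close> picks it. Everything later about
  \<open>delta2\<close> rests on these two facts.\<close>

lemma delta2_lin_hom: "delta2 K n L \<in> lin_hom K (tensor_power K (2 * n - 1) L) (tensor_power K n L)"
  and delta2_pure_tensor: "zs \<in> tuples (2 * n - 1) (carrier L) \<Longrightarrow>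
    delta2 K n L (pure_tensor K (2 * n - 1) L zs) =
      leibniz_defect n L (tensor_power K n L) (pure_tensor K n L) zs"
proof -
  have eq: "delta2 K n L = the_lin K (tensor_power K (2 * n - 1) L) (tensor_power K n L)
       (tuples (2 * n - 1) (carrier L)) (pure_tensor K (2 * n - 1) L)
       (leibniz_defect n L (tensor_power K n L) (pure_tensor K n L))"
    unfolding delta2_def leibniz_defect_def by (rule refl)
  obtain h where h: "h \<in> lin_hom K (tensor_power K (2 * n - 1) L) (tensor_power K n L)"
    "\<And>zs. zs \<in> tuples (2 * n - 1) (carrier L) \<Longrightarrow> h (pure_tensor K (2 * n - 1) L zs) =
      leibniz_defect n L (tensor_power K n L) (pure_tensor K n L) zs"
    using tensor_lift[OF mod_L mod_tensor
        leibniz_defect_multilinear[OF mod_tensor pure_tensor_multilinear[OF mod_L]]] by blast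
  note * = the_lin[OF mod_tensor mod_tensor lin_span_pure_tensor[OF mod_L] h]
  show "delta2 K n L \<in> lin_hom K (tensor_power K (2 * n - 1) L) (tensor_power K n L)"
    unfolding eq by (rule *(1))
  show "zs \<in> tuples (2 * n - 1) (carrier L) \<Longrightarrow>
    delta2 K n L (pure_tensor K (2 * n - 1) L zs) =
      leibniz_defect n L (tensor_power K n L) (pure_tensor K n L) zs"
    unfolding eq by (rule *(2))
qed

lemma submodule_delta2_range: "submodule (delta2_range K n L) K (tensor_power K n L)"
  unfolding delta2_range_def by (rule submodule_image[OF mod_tensor mod_tensor delta2_lin_hom])

lemma module_star_space: "module K (star_space K n L)"
  unfolding star_space_def by (rule module_quot[OF mod_tensor submodule_delta2_range])

lemma star_quot_lin_hom:
  "(\<lambda>t. delta2_range K n L +>\<^bsub>tensor_power K n L\<^esub> t) \<in> lin_hom K (tensor_power K n L) (star_space K n L)"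
  unfolding star_space_def by (rule quot_map_lin_hom[OF mod_tensor submodule_delta2_range])

lemma lin_span_star_space:
  "lin_span K (star_space K n L) (star K n L ` tuples n (carrier L)) = carrier (star_space K n L)"
proof -
  have "lin_span K (star_space K n L) ((\<lambda>t. delta2_range K n L +>\<^bsub>tensor_power K n L\<^esub> t) `
      pure_tensor K n L ` tuples n (carrier L)) = carrier (star_space K n L)"
    by (rule lin_span_surj_image[OF mod_tensor module_star_space star_quot_lin_hom _
          lin_span_pure_tensor[OF mod_L]]) (simp add: star_space_def quot_carrier)
  moreover have "star K n L = (\<lambda>xs. delta2_range K n L +>\<^bsub>tensor_power K n L\<^esub> pure_tensor K n L xs)"
    by (simp add: star_def fun_eq_iff)
  ultimately show ?thesis by (simp add: image_image)
qed

lemma star_space_multilinear: "multilinear K n L (star_space K n L) (star K n L)"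
proof -
  have "star K n L = (\<lambda>xs. delta2_range K n L +>\<^bsub>tensor_power K n L\<^esub> pure_tensor K n L xs)"
    by (simp add: star_def fun_eq_iff)
  then show ?thesis
    using multilinear_lin_comp[OF mod_L pure_tensor_multilinear[OF mod_L] star_quot_lin_hom] by simp
qed

text \<open>By naturality the defect of \<open>star\<close> at the concatenated list is the class of
  a value of \<open>delta2\<close>, which is zero in the cokernel.\<close>

lemma star_space_balanced: "leibniz_balanced n L (star_space K n L) (star K n L)"
  unfolding leibniz_balanced_def
proof (intro ballI)
  fix xs ys assume xs: "xs \<in> tuples n (carrier L)" and ys: "ys \<in> tuples (n - 1) (carrier L)"
  interpret S: module K "star_space K n L" by (rule module_star_space)
  define q where "q = (\<lambda>t. delta2_range K n L +>\<^bsub>tensor_power K n L\<^esub> t)"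
  have q: "q \<in> lin_hom K (tensor_power K n L) (star_space K n L)"
    unfolding q_def by (rule star_quot_lin_hom)
  have star: "star K n L = (\<lambda>xs. q (pure_tensor K n L xs))"
    by (simp add: star_def q_def fun_eq_iff)
  note zs = append_tuple[OF xs ys]
  have "leibniz_defect n L (star_space K n L) (star K n L) (xs @ ys) =
      q (leibniz_defect n L (tensor_power K n L) (pure_tensor K n L) (xs @ ys))"
    unfolding star
    by (rule lin_hom_leibniz_defect[symmetric, OF mod_tensor pure_tensor_multilinear[OF mod_L]
          module_star_space q zs])
  also have "\<dots> = q (delta2 K n L (pure_tensor K (2 * n - 1) L (xs @ ys)))"
    by (simp only: delta2_pure_tensor[OF zs])
  also have "\<dots> = \<zero>\<^bsub>star_space K n L\<^esub>"
    unfolding q_def star_space_def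
    by (rule quot_map_eq_zero[OF mod_tensor submodule_delta2_range])
      (unfold delta2_range_def, intro imageI multilinear_closed[OF pure_tensor_multilinear[OF mod_L] zs])
  finally have "leibniz_defect n L (star_space K n L) (star K n L) (xs @ ys) = \<zero>\<^bsub>star_space K n L\<^esub>" .
  moreover have "take n (xs @ ys) = xs" "drop n (xs @ ys) = ys"
    using tuples_length[OF xs] by auto
  ultimately have "star K n L (bracket L xs # ys) \<ominus>\<^bsub>star_space K n L\<^esub>
      (\<Oplus>\<^bsub>star_space K n L\<^esub>i\<in>{..<n}. star K n L (xs[i := bracket L (xs ! i # ys)])) = \<zero>\<^bsub>star_space K n L\<^esub>"
    unfolding leibniz_defect_def Let_def by simp
  then show "star K n L (bracket L xs # ys) =
      (\<Oplus>\<^bsub>star_space K n L\<^esub>i\<in>{..<n}. star K n L (xs[i := bracket L (xs ! i # ys)]))"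
    by (rule S.eq_of_minus_eq_zero)
      (auto intro!: S.finsum_closed multilinear_closed[OF star_space_multilinear]
        tuples_bracket_at[OF xs ys] tuples_bracket_Cons[OF xs ys])
qed

text \<open>The extension of \<open>f\<close> to the tensor power, composed with
  \<open>delta2\<close>, sends a pure tensor to the defect of \<open>f\<close>. Balancedness makes
  this zero, so the extension passes to the cokernel.\<close>

lemma star_space_lift:
  assumes "module K N" "multilinear K n L N f" "leibniz_balanced n L N f"
  shows "\<exists>h\<in>lin_hom K (star_space K n L) N. \<forall>xs\<in>tuples n (carrier L). h (star K n L xs) = f xs"
proof -
  obtain h where h: "h \<in> lin_hom K (tensor_power K n L) N"
    "\<And>xs. xs \<in> tuples n (carrier L) \<Longrightarrow> h (pure_tensor K n L xs) = f xs"
    using tensor_lift[OF mod_L assms(1,2)] by blast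
  interpret N: module K N by fact
  have hd: "h (delta2 K n L t) = \<zero>\<^bsub>N\<^esub>" if "t \<in> carrier (tensor_power K (2 * n - 1) L)" for t
  proof (rule lin_hom_eq_on_span[OF mod_tensor assms(1) lin_hom_comp[OF delta2_lin_hom h(1)] _
        lin_span_pure_tensor[OF mod_L] _ that])
    show "(\<lambda>t. \<zero>\<^bsub>N\<^esub>) \<in> lin_hom K (tensor_power K (2 * n - 1) L) N"
      by (rule lin_homI) auto
    fix t assume "t \<in> pure_tensor K (2 * n - 1) L ` tuples (2 * n - 1) (carrier L)"
    then obtain zs where zs: "zs \<in> tuples (2 * n - 1) (carrier L)" and t: "t = pure_tensor K (2 * n - 1) L zs"
      by blast
    have "h (delta2 K n L t) = leibniz_defect n L N (\<lambda>xs. h (pure_tensor K n L xs)) zs"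
      unfolding t delta2_pure_tensor[OF zs]
      by (rule lin_hom_leibniz_defect[OF mod_tensor pure_tensor_multilinear[OF mod_L] assms(1) h(1) zs])
    also have "\<dots> = leibniz_defect n L N f zs"
      by (rule leibniz_defect_cong[OF assms(1) h(2) assms(2) zs])
    also have "\<dots> = \<zero>\<^bsub>N\<^esub>"
      by (rule leibniz_defect_eq_zero[OF assms zs])
    finally show "h (delta2 K n L t) = \<zero>\<^bsub>N\<^esub>" .
  qed
  have "\<exists>h'\<in>lin_hom K (star_space K n L) N. \<forall>t\<in>carrier (tensor_power K n L).
      h' (delta2_range K n L +>\<^bsub>tensor_power K n L\<^esub> t) = h t"
    unfolding star_space_def
    by (rule quot_lift[OF mod_tensor submodule_delta2_range assms(1) h(1)])
      (use hd in \<open>auto simp: delta2_range_def\<close>)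
  then obtain h' where h': "h' \<in> lin_hom K (star_space K n L) N"
    "\<And>t. t \<in> carrier (tensor_power K n L) \<Longrightarrow>
      h' (delta2_range K n L +>\<^bsub>tensor_power K n L\<^esub> t) = h t" by blast
  have "h' (star K n L xs) = f xs" if "xs \<in> tuples n (carrier L)" for xs
    unfolding star_def
    using h'(2)[OF multilinear_closed[OF pure_tensor_multilinear[OF mod_L] that]] h(2)[OF that] by simp
  with h'(1) show ?thesis by blast
qed

end

section \<open>The Leibniz algebra structure on the tensor power\<close>

text \<open>A transfer principle: the vector space \<open>star_space\<close> and the algebra
  \<open>star_power\<close> have different record types but the same linear structure, and so do
  \<open>L\<close> and \<open>forget n k L\<close> apart from the bracket.\<close>

lemma module_cong:
  assumes "carrier N = carrier M" "add N = add M" "zero N = zero M" "smult N = smult M"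
  shows "module K N \<longleftrightarrow> module K M"
  unfolding module_def module_axioms_def abelian_group_def abelian_monoid_def
    abelian_group_axioms_def comm_group_def comm_monoid_def comm_monoid_axioms_def monoid_def
    group_def group_axioms_def Units_def
  by (simp add: assms)

lemma submodule_cong:
  assumes "carrier N = carrier M" "add N = add M" "zero N = zero M" "smult N = smult M"
  shows "submodule H K N \<longleftrightarrow> submodule H K M"
  unfolding submodule_def submodule_axioms_def subgroup_def m_inv_def
  by (simp add: assms)

lemma lin_span_cong:
  assumes "carrier N = carrier M" "add N = add M" "zero N = zero M" "smult N = smult M"
  shows "lin_span K N S = lin_span K M S"
  unfolding lin_span_def by (simp add: submodule_cong[OF assms])

lemma finsum_module_cong:
  assumes "carrier N = carrier M" "add N = add M" "zero N = zero M"
  shows "finsum N f I = finsum M f I"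
  unfolding finsum_def finprod_def by (simp add: assms)

lemma multilinear_cong:
  assumes "\<And>xs. xs \<in> tuples n (carrier M) \<Longrightarrow> f xs = g xs" "module K M" "multilinear K n M N g"
  shows "multilinear K n M N f"
proof (rule multilinearI[OF assms(2)])
  fix xs assume xs: "xs \<in> tuples n (carrier M)"
  then show "f xs \<in> carrier N" using assms(1) multilinear_closed[OF assms(3)] by simp
  fix i assume i: "i < n"
  show "(\<lambda>x. f (xs[i := x])) \<in> lin_hom K M N"
    by (rule lin_hom_cong[OF assms(2) _ multilinear_slot[OF assms(3) xs i]])
      (simp add: assms(1) tuples_update[OF xs])
qed

lemma star_power_simps:
  "carrier (star_power K n L) = carrier (star_space K n L)"
  "add (star_power K n L) = add (star_space K n L)"
  "zero (star_power K n L) = zero (star_space K n L)"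
  "smult (star_power K n L) = smult (star_space K n L)"
  "bracket (star_power K n L) = star_bracket K n L"
  by (simp_all add: star_power_def module.defs leibniz.defs)

context leibniz_algebra_pos
begin

abbreviation "S \<equiv> star_power K n L"

lemma module_star_power: "module K S"
  using module_star_space module_cong[OF star_power_simps(1-4)] by blast

lemma lin_span_star: "lin_span K S (star K n L ` tuples n (carrier L)) = carrier S"
  unfolding lin_span_cong[OF star_power_simps(1-4)] star_power_simps(1) by (rule lin_span_star_space)

lemma star_multilinear: "multilinear K n L S (star K n L)"
  using star_space_multilinear unfolding multilinear_def star_power_simps .

lemma star_balanced: "leibniz_balanced n L S (star K n L)"
  using star_space_balanced
  unfolding leibniz_balanced_def finsum_module_cong[OF star_power_simps(1-3)] .

lemma star_lift:
  assumes "module K N" "multilinear K n L N f" "leibniz_balanced n L N f"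
  shows "\<exists>h\<in>lin_hom K S N. \<forall>xs\<in>tuples n (carrier L). h (star K n L xs) = f xs"
  using star_space_lift[OF assms] unfolding lin_hom_def star_power_simps .

lemma star_closed: "xs \<in> tuples n (carrier L) \<Longrightarrow> star K n L xs \<in> carrier S"
  by (rule multilinear_closed[OF star_multilinear])

lemma bracket_balanced: "leibniz_balanced n L L (bracket L)"
  unfolding leibniz_balanced_def using leibniz_identity by blast

text \<open>The bracket is balanced by the Leibniz identity, so \<open>star_lift\<close> provides
  the map that the description of \<open>star_map\<close> asks for.\<close>

lemma star_map_lin_hom: "star_map K n L \<in> lin_hom K S L"
  and star_map_star: "xs \<in> tuples n (carrier L) \<Longrightarrow> star_map K n L (star K n L xs) = bracket L xs"
proof -
  obtain h where h: "h \<in> lin_hom K S L"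
    "\<And>xs. xs \<in> tuples n (carrier L) \<Longrightarrow> h (star K n L xs) = bracket L xs"
    using star_lift[OF mod_L bracket_multilinear bracket_balanced] by blast
  note * = the_lin[OF module_star_power mod_L lin_span_star h]
  show "star_map K n L \<in> lin_hom K S L" unfolding star_map_def by (rule *(1))
  show "xs \<in> tuples n (carrier L) \<Longrightarrow> star_map K n L (star K n L xs) = bracket L xs"
    unfolding star_map_def by (rule *(2))
qed

lemma star_map_closed: "t \<in> carrier S \<Longrightarrow> star_map K n L t \<in> carrier L"
  by (rule lin_hom_closed[OF star_map_lin_hom])

lemma map_star_map_tuples: "ts \<in> tuples m (carrier S) \<Longrightarrow> map (star_map K n L) ts \<in> tuples m (carrier L)"
  by (rule tuples_map[OF star_map_closed])

lemma star_map_multilinear: "multilinear K n S S (\<lambda>ts. star K n L (map (star_map K n L) ts))"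
  by (rule multilinear_comp_map[OF module_star_power star_map_lin_hom star_multilinear])

text \<open>The right-hand side is an explicit candidate for the described bracket: it is
  multilinear, and it has the prescribed values because \<open>star_map\<close> sends
  \<open>star\<close> of a list to its bracket. A competitor agrees with it on tuples of
  \<open>star\<close> elements, hence everywhere.\<close>

lemma bracket_star_power:
  assumes "ts \<in> tuples n (carrier S)"
  shows "bracket S ts = star K n L (map (star_map K n L) ts)"
proof -
  \<comment> \<open>The restriction meets the \<open>extensional\<close> requirement, so that
    uniqueness is an equality of functions.\<close>
  define b where "b = restrict (\<lambda>ts. star K n L (map (star_map K n L) ts)) (tuples n (carrier S))"
  have star_tuples: "map (star K n L) xss \<in> tuples n (carrier S)"
    if "xss \<in> tuples n (tuples n (carrier L))" for xss
    by (rule tuples_map[OF star_closed that])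
  have "star_bracket K n L = b"
    unfolding star_bracket_def
  proof (rule the_equality)
    have "multilinear K n S S b"
      by (rule multilinear_cong[OF _ module_star_power star_map_multilinear]) (simp add: b_def)
    moreover have "b (map (star K n L) xss) = star K n L (map (bracket L) xss)"
      if xss: "xss \<in> tuples n (tuples n (carrier L))" for xss
    proof -
      have "map (star_map K n L) (map (star K n L) xss) = map (bracket L) xss"
        using xss by (auto simp: tuples_def star_map_star subset_iff)
      then show ?thesis by (simp add: b_def star_tuples[OF xss] del: map_map)
    qed
    ultimately show "multilinear K n (star_space K n L) (star_space K n L) b \<and>
        b \<in> extensional (tuples n (carrier (star_space K n L))) \<and>
        (\<forall>xss\<in>tuples n (tuples n (carrier L)).
           b (map (star K n L) xss) = star K n L (map (bracket L) xss))"
      by (simp add: multilinear_def star_power_simps b_def)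
    then have b_star: "b (map (star K n L) xss) = star K n L (map (bracket L) xss)"
      if "xss \<in> tuples n (tuples n (carrier L))" for xss
      using that by blast
    fix c assume c: "multilinear K n (star_space K n L) (star_space K n L) c \<and>
        c \<in> extensional (tuples n (carrier (star_space K n L))) \<and>
        (\<forall>xss\<in>tuples n (tuples n (carrier L)).
           c (map (star K n L) xss) = star K n L (map (bracket L) xss))"
    show "c = b"
    proof (rule extensionalityI)
      show "c \<in> extensional (tuples n (carrier S))" using c by (simp add: star_power_simps)
      show "b \<in> extensional (tuples n (carrier S))" by (simp add: b_def)
      fix us assume us: "us \<in> tuples n (carrier S)"
      show "c us = b us"
      proof (rule multilinear_eq_on_span[OF module_star_power module_star_power _ _ lin_span_star _ us])
        show "multilinear K n S S c" using c by (simp add: multilinear_def star_power_simps)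
        show "multilinear K n S S b" by fact
        fix vs assume "vs \<in> tuples n (star K n L ` tuples n (carrier L))"
        then obtain xss where "xss \<in> tuples n (tuples n (carrier L))" "vs = map (star K n L) xss"
          unfolding tuples_image by blast
        then show "c vs = b vs" using c b_star by simp
      qed
    qed
  qed
  then show ?thesis using assms by (simp add: star_power_simps(5) b_def)
qed

lemma star_map_bracket:
  assumes "ts \<in> tuples n (carrier S)"
  shows "star_map K n L (bracket S ts) = bracket L (map (star_map K n L) ts)"
  using bracket_star_power[OF assms] star_map_star[OF map_star_map_tuples[OF assms]] by simp

text \<open>Brackets are \<open>star\<close> of images in \<open>L\<close>, and
  \<open>star_map\<close> respects brackets. Hence the identity at \<open>ts\<close> and
  \<open>us\<close> is the balancedness of \<open>star\<close> at their images.\<close>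

lemma leibniz_algebra_star_power: "leibniz_algebra n K S"
proof -
  interpret S: module K S by (rule module_star_power)
  let ?d = "star_map K n L"
  have bmult: "multilinear K n S S (bracket S)"
    by (rule multilinear_cong[OF bracket_star_power module_star_power star_map_multilinear])
  have "bracket S (bracket S ts # us) = (\<Oplus>\<^bsub>S\<^esub>i\<in>{..<n}. bracket S (ts[i := bracket S (ts ! i # us)]))"
    if ts: "ts \<in> tuples n (carrier S)" and us: "us \<in> tuples (n - 1) (carrier S)" for ts us
  proof -
    note bts = multilinear_closed[OF bmult ts]
    note dts = map_star_map_tuples[OF ts] and dus = map_star_map_tuples[OF us]
    have Cons: "t # us \<in> tuples n (carrier S)" if "t \<in> carrier S" for t
      using that us n_pos by (simp add: tuples_Cons)
    have "bracket S (bracket S ts # us) = star K n L (map ?d (bracket S ts # us))"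
      by (rule bracket_star_power[OF Cons[OF bts]])
    also have "\<dots> = star K n L (bracket L (map ?d ts) # map ?d us)"
      using star_map_bracket[OF ts] by simp
    also have "\<dots> = (\<Oplus>\<^bsub>S\<^esub>i\<in>{..<n}. star K n L ((map ?d ts)[i := bracket L (map ?d ts ! i # map ?d us)]))"
      using star_balanced dts dus unfolding leibniz_balanced_def by blast
    also have "\<dots> = (\<Oplus>\<^bsub>S\<^esub>i\<in>{..<n}. bracket S (ts[i := bracket S (ts ! i # us)]))"
    proof (rule S.finsum_cong'[OF refl])
      fix i assume "i \<in> {..<n}"
      then have i: "i < n" by simp
      note tus = Cons[OF tuples_nth[OF ts i]]
      note u = tuples_update[OF ts multilinear_closed[OF bmult tus]]
      show "star K n L ((map ?d ts)[i := bracket L (map ?d ts ! i # map ?d us)]) =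
          bracket S (ts[i := bracket S (ts ! i # us)])"
        using star_map_bracket[OF tus] bracket_star_power[OF u] i tuples_length[OF ts]
        by (simp add: map_update)
    qed (auto intro!: multilinear_closed[OF bmult] tuples_update[OF ts] Cons tuples_nth[OF ts])
    finally show ?thesis .
  qed
  then show ?thesis
    by (intro leibniz_algebra.intro leibniz_algebra_axioms.intro module_star_power bmult
        field_axioms) auto
qed

end

section \<open>Nested brackets\<close>

text \<open>The arguments of the outermost operation in a bracket nested \<open>Suc k\<close> times.
  Keeping this list apart from the operation allows the operation to be exchanged for
  \<open>star\<close>, which yields the formula for \<phi>.\<close>

definition nest_last :: "nat \<Rightarrow> nat \<Rightarrow> ('a list \<Rightarrow> 'a) \<Rightarrow> 'a list \<Rightarrow> 'a list" where
  "nest_last n k b xs = take (n - 1) xs @ [nested n k b (drop (n - 1) xs)]"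

lemma nested_Suc: "nested n (Suc k) b xs = b (nest_last n k b xs)"
  by (simp add: nest_last_def)

text \<open>Applied with \<open>m = n - 1\<close>: the first \<open>m\<close> of the p slots are
  outer ones, the remaining \<open>q\<close> belong to the inner nested bracket.\<close>

lemma (in abelian_monoid) finsum_split:
  fixes m q :: nat
  assumes "f \<in> {..<m + q} \<rightarrow> carrier G"
  shows "finsum G f {..<m + q} = finsum G f {..<m} \<oplus> finsum G (\<lambda>j. f (m + j)) {..<q}"
  using assms
proof (induction q)
  case 0
  then show ?case by (simp add: finsum_closed)
next
  case (Suc q)
  have c: "f (m + q) \<in> carrier G" "f \<in> {..<m} \<rightarrow> carrier G" "(\<lambda>j. f (m + j)) \<in> {..<q} \<rightarrow> carrier G"
    "f \<in> {..<m + q} \<rightarrow> carrier G"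
    using Suc.prems by auto
  then show ?case
    using Suc.IH by (simp add: lessThan_Suc finsum_closed a_ac)
qed

lemma nest_last_tuples:
  assumes "n > 0" "xs \<in> tuples (Suc k * (n - 1) + 1) C"
    and "\<And>ys. ys \<in> tuples (k * (n - 1) + 1) C \<Longrightarrow> nested n k b ys \<in> C"
  shows "nest_last n k b xs \<in> tuples n C"
proof -
  have "take (n - 1) xs \<in> tuples (n - 1) C"
    using tuples_take[OF assms(2), of "n - 1"] by simp
  moreover have "nested n k b (drop (n - 1) xs) \<in> C"
    using assms(3) tuples_drop[OF assms(2), of "n - 1"] by simp
  ultimately show ?thesis
    using assms(1) by (auto simp: nest_last_def tuples_def)
qed

text \<open>Cutting \<open>xs\<close> after \<open>n - 1\<close> entries separates the two kinds of
  slots: those in the prefix keep their position, all later ones are absorbed into the last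
  entry.\<close>

lemma nest_last_update:
  assumes "length xs \<ge> n - 1"
  shows "i < n - 1 \<Longrightarrow> nest_last n k b (xs[i := x]) = (nest_last n k b xs)[i := x]"
    and "nest_last n k b (xs[(n - 1) + j := x]) =
      (nest_last n k b xs)[n - 1 := nested n k b ((drop (n - 1) xs)[j := x])]"
proof -
  define us vs where "us = take (n - 1) xs" and "vs = drop (n - 1) xs"
  have xs: "xs = us @ vs" and us: "n - 1 = length us"
    using assms by (simp_all add: us_def vs_def)
  show "i < n - 1 \<Longrightarrow> nest_last n k b (xs[i := x]) = (nest_last n k b xs)[i := x]"
    unfolding nest_last_def us xs by (simp add: list_update_append)
  show "nest_last n k b (xs[(n - 1) + j := x]) =
      (nest_last n k b xs)[n - 1 := nested n k b ((drop (n - 1) xs)[j := x])]"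
    unfolding nest_last_def us xs by (simp add: list_update_append)
qed

lemma nest_last_nth:
  assumes "length xs \<ge> n - 1"
  shows "i < n - 1 \<Longrightarrow> nest_last n k b xs ! i = xs ! i"
    and "nest_last n k b xs ! (n - 1) = nested n k b (drop (n - 1) xs)"
  using assms by (auto simp: nest_last_def nth_append min_def)

lemma nest_last_multilinear:
  assumes "module K M" "n > 0" "multilinear K (k * (n - 1) + 1) M M (nested n k b)"
    and "multilinear K n M N g"
  shows "multilinear K (Suc k * (n - 1) + 1) M N (\<lambda>xs. g (nest_last n k b xs))"
proof (rule multilinearI[OF assms(1)])
  fix xs assume xs: "xs \<in> tuples (Suc k * (n - 1) + 1) (carrier M)"
  note nl = nest_last_tuples[OF assms(2) xs multilinear_closed[OF assms(3)]]
  then show "g (nest_last n k b xs) \<in> carrier N"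
    by (rule multilinear_closed[OF assms(4)])
  have len: "length xs \<ge> n - 1" using tuples_length[OF xs] by simp
  fix i assume i: "i < Suc k * (n - 1) + 1"
  show "(\<lambda>x. g (nest_last n k b (xs[i := x]))) \<in> lin_hom K M N"
  proof (cases "i < n - 1")
    case True
    with multilinear_slot[OF assms(4) nl, of i] show ?thesis
      by (simp add: nest_last_update(1)[OF len])
  next
    case False
    define j where "j = i - (n - 1)"
    then have j: "i = (n - 1) + j" using False by simp
    have d: "drop (n - 1) xs \<in> tuples (k * (n - 1) + 1) (carrier M)"
      using tuples_drop[OF xs, of "n - 1"] by simp
    have "j < k * (n - 1) + 1" using i j by simp
    from lin_hom_comp[OF multilinear_slot[OF assms(3) d this] multilinear_slot[OF assms(4) nl, of "n - 1"]]
    show ?thesis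
      unfolding j nest_last_update(2)[OF len] using assms(2) by simp
  qed
qed

lemma nested_multilinear:
  assumes "module K M" "n > 0" "multilinear K n M M b"
  shows "multilinear K (k * (n - 1) + 1) M M (nested n k b)"
proof (induction k)
  case 0
  show ?case
  proof (rule multilinearI[OF assms(1)])
    fix xs assume xs: "xs \<in> tuples (0 * (n - 1) + 1) (carrier M)"
    then obtain y where y: "xs = [y]" "y \<in> carrier M"
      by (auto simp: tuples_def length_Suc_conv)
    then show "nested n 0 b xs \<in> carrier M" by simp
    fix i assume "i < 0 * (n - 1) + 1"
    then show "(\<lambda>x. nested n 0 b (xs[i := x])) \<in> lin_hom K M M"
      using y by (auto intro!: lin_homI)
  qed
next
  case (Suc k)
  from nest_last_multilinear[OF assms(1,2) Suc assms(3)] show ?case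
    by (simp only: nested_Suc)
qed

lemma nested_closed:
  assumes "module K M" "n > 0" "multilinear K n M M b" "xs \<in> tuples (k * (n - 1) + 1) (carrier M)"
  shows "nested n k b xs \<in> carrier M"
  by (rule multilinear_closed[OF nested_multilinear[OF assms(1-3)] assms(4)])

text \<open>Membership in \<open>A\<close> is proved along with the equation because
  \<open>hom\<close> speaks about tuples in \<open>A\<close> only, and the last entry of such a
  tuple is itself a nested value.\<close>

lemma nested_map:
  assumes "n > 0" and closed: "\<And>xs. xs \<in> tuples n A \<Longrightarrow> b xs \<in> A"
    and hom: "\<And>xs. xs \<in> tuples n A \<Longrightarrow> f (b xs) = c (map f xs)"
    and "xs \<in> tuples (k * (n - 1) + 1) A"
  shows "nested n k b xs \<in> A \<and> f (nested n k b xs) = nested n k c (map f xs)"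
  using assms(4)
proof (induction k arbitrary: xs)
  case 0
  then obtain y where "xs = [y]" "y \<in> A" by (auto simp: tuples_def length_Suc_conv)
  then show ?case by simp
next
  case (Suc k)
  have d: "drop (n - 1) xs \<in> tuples (k * (n - 1) + 1) A"
    using tuples_drop[OF Suc.prems, of "n - 1"] by simp
  have "nest_last n k b xs \<in> tuples n A"
    by (rule nest_last_tuples[OF assms(1) Suc.prems]) (use Suc.IH in blast)
  moreover have "map f (nest_last n k b xs) = nest_last n k c (map f xs)"
    using Suc.IH[OF d] by (simp add: nest_last_def take_map drop_map)
  ultimately show ?case
    by (simp only: nested_Suc closed hom)
qed

lemma map_nest_last:
  assumes "n > 0" "\<And>xs. xs \<in> tuples n A \<Longrightarrow> b xs \<in> A"
    and "\<And>xs. xs \<in> tuples n A \<Longrightarrow> f (b xs) = c (map f xs)"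
    and "xs \<in> tuples (Suc k * (n - 1) + 1) A"
  shows "map f (nest_last n k b xs) = nest_last n k c (map f xs)"
proof -
  have d: "drop (n - 1) xs \<in> tuples (k * (n - 1) + 1) A"
    using tuples_drop[OF assms(4), of "n - 1"] by simp
  from nested_map[where f = f and c = c, OF assms(1-3) d] show ?thesis
    by (simp add: nest_last_def take_map drop_map)
qed

text \<open>A regrouping of n summands into p. The first \<open>n - 1\<close> summands agree on both
  sides; in the last one \<open>D\<close> hits a nested bracket, which \<open>deriv\<close> expands
  into one term for each remaining slot, and linearity of \<open>g\<close> in its last slot moves
  that sum outside.\<close>

lemma sum_derivation_nest_last:
  assumes M: "module K M" and N: "module K N" and n: "n > 0" and b: "multilinear K n M M b"
    and g: "multilinear K n M N g" and D: "\<And>x. x \<in> carrier M \<Longrightarrow> D x \<in> carrier M"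
    and deriv: "\<And>ys. ys \<in> tuples (k * (n - 1) + 1) (carrier M) \<Longrightarrow> D (nested n k b ys) =
      (\<Oplus>\<^bsub>M\<^esub>j\<in>{..<k * (n - 1) + 1}. nested n k b (ys[j := D (ys ! j)]))"
    and xs: "xs \<in> tuples (Suc k * (n - 1) + 1) (carrier M)"
  shows "(\<Oplus>\<^bsub>N\<^esub>i\<in>{..<n}. g ((nest_last n k b xs)[i := D (nest_last n k b xs ! i)])) =
    (\<Oplus>\<^bsub>N\<^esub>i\<in>{..<Suc k * (n - 1) + 1}. g (nest_last n k b (xs[i := D (xs ! i)])))"
proof -
  interpret N: module K N by fact
  define m q where "m = n - 1" and "q = k * (n - 1) + 1"
  have nm: "n = m + 1" and pq: "Suc k * (n - 1) + 1 = m + q"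
    using n by (auto simp: m_def q_def)
  let ?nl = "nest_last n k b xs"
  let ?f = "\<lambda>i. g (?nl[i := D (?nl ! i)])" and ?h = "\<lambda>i. g (nest_last n k b (xs[i := D (xs ! i)]))"
  note nested = nested_closed[OF M n b]
  have len: "length xs \<ge> n - 1" using tuples_length[OF xs] by simp
  have nl: "?nl \<in> tuples n (carrier M)" by (rule nest_last_tuples[OF n xs nested])
  have d: "drop m xs \<in> tuples q (carrier M)"
    using tuples_drop[OF xs, of m] by (simp add: m_def q_def)
  have mn: "m < n" using nm by simp
  have nested_q: "nested n k b ys \<in> carrier M" if "ys \<in> tuples q (carrier M)" for ys
    using that unfolding q_def by (rule nested)
  have "?f \<in> {..<n} \<rightarrow> carrier N"
    by (auto intro!: multilinear_closed[OF g] tuples_update[OF nl] D tuples_nth[OF nl])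
  then have fc: "?f \<in> {..<m + 1} \<rightarrow> carrier N"
    by (simp only: nm[symmetric])
  have hc: "?h \<in> {..<m + q} \<rightarrow> carrier N"
    unfolding pq[symmetric]
    by (auto intro!: multilinear_closed[OF g] nest_last_tuples[OF n _ nested] tuples_update[OF xs]
        D tuples_nth[OF xs] simp del: mult_Suc)
  have fh: "?f i = ?h i" if "i < m" for i
    using that by (simp add: nest_last_update(1)[OF len] nest_last_nth(1)[OF len] m_def)
  have last: "?h (m + j) = g (?nl[m := nested n k b ((drop m xs)[j := D (drop m xs ! j)])])" for j
    using len unfolding m_def nest_last_update(2)[OF len] by simp
  have "?f m = g (?nl[m := (\<Oplus>\<^bsub>M\<^esub>j\<in>{..<q}. nested n k b ((drop m xs)[j := D (drop m xs ! j)]))])"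
    using deriv[OF d[unfolded q_def]] nest_last_nth(2)[OF len, of k b] by (simp add: m_def q_def)
  also have "\<dots> = (\<Oplus>\<^bsub>N\<^esub>j\<in>{..<q}. g (?nl[m := nested n k b ((drop m xs)[j := D (drop m xs ! j)])]))"
    by (rule lin_hom_finsum[OF M N multilinear_slot[OF g nl mn]])
      (auto simp del: nth_drop intro!: nested_q tuples_update[OF d] D tuples_nth[OF d])
  finally have fm: "?f m = (\<Oplus>\<^bsub>N\<^esub>j\<in>{..<q}. ?h (m + j))"
    by (simp only: last)
  have "finsum N ?f {..<n} = finsum N ?f {..<m} \<oplus>\<^bsub>N\<^esub> finsum N (\<lambda>j. ?f (m + j)) {..<1}"
    using N.finsum_split[OF fc] by (simp only: nm[symmetric])
  also have "finsum N (\<lambda>j. ?f (m + j)) {..<1} = ?f m"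
  proof -
    have "?f m \<in> carrier N" using fc by auto
    then show ?thesis by (simp add: lessThan_Suc)
  qed
  also have "finsum N ?f {..<m} = finsum N ?h {..<m}"
    by (rule N.finsum_cong'[OF refl _ fh]) (use hc in auto)
  also have "finsum N ?h {..<m} \<oplus>\<^bsub>N\<^esub> ?f m = finsum N ?h {..<m + q}"
    unfolding fm by (rule N.finsum_split[OF hc, symmetric])
  finally show ?thesis by (simp only: pq)
qed

text \<open>Induction on \<open>k\<close>: the product rule for \<open>b\<close> treats the
  outermost operation, and the regrouping lemma with \<open>g = b\<close> merges the expansion of
  its last entry into one sum.\<close>

lemma derivation_nested:
  assumes M: "module K M" and n: "n > 0" and b: "multilinear K n M M b"
    and D: "\<And>x. x \<in> carrier M \<Longrightarrow> D x \<in> carrier M"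
    and deriv: "\<And>xs. xs \<in> tuples n (carrier M) \<Longrightarrow>
      D (b xs) = (\<Oplus>\<^bsub>M\<^esub>i\<in>{..<n}. b (xs[i := D (xs ! i)]))"
    and xs: "xs \<in> tuples (k * (n - 1) + 1) (carrier M)"
  shows "D (nested n k b xs) = (\<Oplus>\<^bsub>M\<^esub>i\<in>{..<k * (n - 1) + 1}. nested n k b (xs[i := D (xs ! i)]))"
  using xs
proof (induction k arbitrary: xs)
  case 0
  interpret M: module K M by fact
  from 0 obtain y where "xs = [y]" "y \<in> carrier M" by (auto simp: tuples_def length_Suc_conv)
  then show ?case using D by (simp add: lessThan_Suc)
next
  case (Suc k)
  have "nest_last n k b xs \<in> tuples n (carrier M)"
    by (rule nest_last_tuples[OF n Suc.prems nested_closed[OF M n b]])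
  from deriv[OF this] sum_derivation_nest_last[OF M M n b b D Suc.IH Suc.prems]
  show ?case by (simp only: nested_Suc)
qed

text \<open>With the first \<open>n - 1\<close> entries fixed, the admissible last entries form a
  submodule. It contains all nested brackets, hence everything. Perfectness for arity p uses this
  with \<open>g\<close> the bracket, surjectivity of \<phi> with \<open>g = star\<close> and
  \<open>H\<close> the image.\<close>

lemma nest_last_span:
  assumes M: "module K M" and N: "module K N" and n: "n > 0" and g: "multilinear K n M N g"
    and span: "lin_span K M (nested n k b ` tuples (k * (n - 1) + 1) (carrier M)) = carrier M"
    and H: "submodule H K N"
    and gH: "\<And>xs. xs \<in> tuples (Suc k * (n - 1) + 1) (carrier M) \<Longrightarrow> g (nest_last n k b xs) \<in> H"
    and us: "us \<in> tuples n (carrier M)"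
  shows "g us \<in> H"
proof -
  let ?m = "n - 1"
  have m: "?m < n" using n by simp
  have "nested n k b ` tuples (k * ?m + 1) (carrier M) \<subseteq> {u \<in> carrier M. g (us[?m := u]) \<in> H}"
  proof (rule image_subsetI)
    fix ys assume ys: "ys \<in> tuples (k * ?m + 1) (carrier M)"
    have "nested n k b ys \<in> lin_span K M (nested n k b ` tuples (k * ?m + 1) (carrier M))"
      by (rule subsetD[OF lin_span_superset imageI[OF ys]])
    then have "nested n k b ys \<in> carrier M" unfolding span .
    moreover have "take ?m us @ ys \<in> tuples (Suc k * ?m + 1) (carrier M)"
      using tuples_take[OF us, of ?m] ys by (auto simp: tuples_def)
    moreover have "nest_last n k b (take ?m us @ ys) = us[?m := nested n k b ys]"
      using tuples_length[OF us] m
      by (simp add: nest_last_def upd_conv_take_nth_drop)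
    ultimately show "nested n k b ys \<in> {u \<in> carrier M. g (us[?m := u]) \<in> H}"
      using gH[of "take ?m us @ ys"] by simp
  qed
  from lin_span_carrier_subset[OF span submodule_vimage[OF M N multilinear_slot[OF g us m] H] this]
  have "us ! ?m \<in> {u \<in> carrier M. g (us[?m := u]) \<in> H}"
    by (rule subsetD[OF _ tuples_nth[OF us m]])
  then show ?thesis by simp
qed

text \<open>Perfectness iterates. For \<open>k = 0\<close> the nested values are all elements; in
  the step, n-ary brackets span, and their last entries may be taken to be nested brackets.\<close>

lemma lin_span_nested:
  assumes M: "module K M" and n: "n > 0" and b: "multilinear K n M M b"
    and span: "lin_span K M (b ` tuples n (carrier M)) = carrier M"
  shows "lin_span K M (nested n k b ` tuples (k * (n - 1) + 1) (carrier M)) = carrier M"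
proof (induction k)
  case 0
  show ?case
  proof (rule lin_span_eq_carrierI[OF M])
    have "x \<in> nested n 0 b ` tuples (0 * (n - 1) + 1) (carrier M)" if "x \<in> carrier M" for x
      by (rule image_eqI[of _ _ "[x]"]) (use that in \<open>auto simp: tuples_def\<close>)
    then show "\<And>H. nested n 0 b ` tuples (0 * (n - 1) + 1) (carrier M) \<subseteq> H \<Longrightarrow> carrier M \<subseteq> H"
      by blast
  qed (use nested_closed[OF M n b, of _ 0] in blast)
next
  case (Suc k)
  show ?case
  proof (rule lin_span_eq_carrierI[OF M])
    show "nested n (Suc k) b ` tuples (Suc k * (n - 1) + 1) (carrier M) \<subseteq> carrier M"
      using nested_closed[OF M n b] by blast
    fix H assume H: "submodule H K M" "nested n (Suc k) b ` tuples (Suc k * (n - 1) + 1) (carrier M) \<subseteq> H"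
    have "b us \<in> H" if "us \<in> tuples n (carrier M)" for us
      by (rule nest_last_span[OF M M n b Suc H(1) _ that])
        (use H(2) in \<open>auto simp only: nested_Suc image_subset_iff\<close>)
    then show "carrier M \<subseteq> H"
      by (intro lin_span_carrier_subset[OF span H(1)]) blast
  qed
qed

section \<open>Comparing \<open>n\<close>-ary and \<open>p\<close>-ary tensor powers\<close>

lemma forget_simps:
  "carrier (forget n k L) = carrier L" "add (forget n k L) = add L" "zero (forget n k L) = zero L"
  "smult (forget n k L) = smult L" "bracket (forget n k L) = nested n k (bracket L)"
  by (simp_all add: forget_def)

lemma multilinear_forget:
  "multilinear K p (forget n k L) N f = multilinear K p L N f"
  "multilinear K p M (forget n k L) g = multilinear K p M L g"
  by (simp_all add: multilinear_def forget_simps)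

lemma lin_hom_forget:
  "lin_hom K (forget n k L) N = lin_hom K L N" "lin_hom K M (forget n k L) = lin_hom K M L"
  by (simp_all add: lin_hom_def forget_simps)

text \<open>Here \<open>k\<close> is the depth of the inner nesting, one less than the total number
  of nested brackets, so that an outermost bracket is always present.\<close>

locale leibniz_forget = leibniz_algebra_pos n K L
  for n :: nat and K :: "('k, 'c) ring_scheme" (structure) and L :: "('k, 'a, 'm) leibniz_scheme" (structure) +
  fixes k p :: nat
  assumes n_ge_2: "n \<ge> 2" and p_eq: "p = Suc k * (n - 1) + 1"
begin

lemma nest_last_closed: "xs \<in> tuples p (carrier L) \<Longrightarrow> nest_last n k (bracket L) xs \<in> tuples n (carrier L)"
  unfolding p_eq by (rule nest_last_tuples[OF n_pos _ nested_closed[OF mod_L n_pos bracket_multilinear]])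

text \<open>For \<open>n \<ge> 2\<close> the first entry belongs to the prefix that is kept, so the
  remaining entries \<open>zs\<close> do not depend on it. This turns right multiplication in the
  p-ary bracket into right multiplication in the n-ary one.\<close>

lemma nest_last_Cons:
  assumes "ys \<in> tuples (p - 1) (carrier L)"
  obtains zs where "zs \<in> tuples (n - 1) (carrier L)"
    "\<And>x. nest_last n k (bracket L) (x # ys) = x # zs"
proof -
  obtain m where m: "n - 1 = Suc m" using n_ge_2 by (cases "n - 1") auto
  define zs where "zs = take m ys @ [nested n k (bracket L) (drop m ys)]"
  have nl: "nest_last n k (bracket L) (x # ys) = x # zs" for x
    using m by (simp add: nest_last_def zs_def)
  have "zs \<in> tuples (n - 1) (carrier L)"
  proof -
    \<comment> \<open>Zero serves as a dummy head, just to read off where the entries of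
      \<open>zs\<close> lie.\<close>
    have "\<zero>\<^bsub>L\<^esub> # ys \<in> tuples p (carrier L)" using assms p_eq by (simp add: tuples_Cons)
    from nest_last_closed[OF this] show ?thesis unfolding nl by (simp add: tuples_Cons)
  qed
  with nl that show ?thesis by blast
qed

text \<open>With \<open>g\<close> the bracket this is the Leibniz identity for arity p; with
  \<open>g = star\<close> it is what lets \<phi> exist. Balancedness of \<open>g\<close> gives a sum
  over n entries, and the derivation property of \<open>D\<close> spreads it over p.\<close>

lemma balanced_nest_last:
  assumes N: "module K N" and g: "multilinear K n L N g" and bal: "leibniz_balanced n L N g"
  shows "leibniz_balanced p (forget n (Suc k) L) N (\<lambda>xs. g (nest_last n k (bracket L) xs))"
  unfolding leibniz_balanced_def forget_simps
proof (intro ballI)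
  interpret N: module K N by fact
  fix xs ys assume xs: "xs \<in> tuples p (carrier L)" and ys: "ys \<in> tuples (p - 1) (carrier L)"
  obtain zs where zs: "zs \<in> tuples (n - 1) (carrier L)"
    and nl: "\<And>x. nest_last n k (bracket L) (x # ys) = x # zs"
    using nest_last_Cons[OF ys] by blast
  let ?nl = "nest_last n k (bracket L)"
  define D where "D x = bracket L (x # zs)" for x
  have Dc: "D x \<in> carrier L" if "x \<in> carrier L" for x
    unfolding D_def by (rule bracket_Cons_closed[OF that zs])
  have D: "nested n (Suc k) (bracket L) (x # ys) = D x" for x
    unfolding nested_Suc nl D_def by (rule refl)
  have deriv: "D (bracket L us) = (\<Oplus>\<^bsub>L\<^esub>i\<in>{..<n}. bracket L (us[i := D (us ! i)]))"
    if "us \<in> tuples n (carrier L)" for us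
    unfolding D_def by (rule leibniz_identity[OF that zs])
  have deriv_nested: "D (nested n k (bracket L) us) =
      (\<Oplus>\<^bsub>L\<^esub>j\<in>{..<k * (n - 1) + 1}. nested n k (bracket L) (us[j := D (us ! j)]))"
    if "us \<in> tuples (k * (n - 1) + 1) (carrier L)" for us
    by (rule derivation_nested[OF mod_L n_pos bracket_multilinear Dc deriv that])
  have "g (?nl (nested n (Suc k) (bracket L) xs # ys)) = g (bracket L (?nl xs) # zs)"
    unfolding nl nested_Suc by (rule refl)
  also have "\<dots> = (\<Oplus>\<^bsub>N\<^esub>i\<in>{..<n}. g ((?nl xs)[i := D (?nl xs ! i)]))"
    unfolding D_def using bal nest_last_closed[OF xs] zs unfolding leibniz_balanced_def by blast
  also have "\<dots> = (\<Oplus>\<^bsub>N\<^esub>i\<in>{..<p}. g (?nl (xs[i := D (xs ! i)])))"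
    unfolding p_eq
    by (rule sum_derivation_nest_last[OF mod_L N n_pos bracket_multilinear g Dc deriv_nested
          xs[unfolded p_eq]])
  finally show "g (?nl (nested n (Suc k) (bracket L) xs # ys)) =
      (\<Oplus>\<^bsub>N\<^esub>i\<in>{..<p}. g (?nl (xs[i := nested n (Suc k) (bracket L) (xs ! i # ys)])))"
    by (simp only: D)
qed

lemma leibniz_algebra_forget: "leibniz_algebra p K (forget n (Suc k) L)"
proof (intro leibniz_algebra.intro leibniz_algebra_axioms.intro field_axioms)
  show "module K (forget n (Suc k) L)"
    using mod_L module_cong[OF forget_simps(1-4)] by blast
  show "multilinear K p (forget n (Suc k) L) (forget n (Suc k) L) (bracket (forget n (Suc k) L))"
    unfolding multilinear_forget forget_simps p_eq
    by (rule nested_multilinear[OF mod_L n_pos bracket_multilinear])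
  show "bracket (forget n (Suc k) L) (bracket (forget n (Suc k) L) xs # ys) =
      (\<Oplus>\<^bsub>forget n (Suc k) L\<^esub>i\<in>{..<p}. bracket (forget n (Suc k) L)
        (xs[i := bracket (forget n (Suc k) L) (xs ! i # ys)]))"
    if "xs \<in> tuples p (carrier (forget n (Suc k) L))" "ys \<in> tuples (p - 1) (carrier (forget n (Suc k) L))"
    for xs ys
    using balanced_nest_last[OF mod_L bracket_multilinear bracket_balanced] that
    unfolding leibniz_balanced_def finsum_module_cong[OF forget_simps(1-3)] forget_simps(5) nested_Suc
    by blast
qed

text \<open>The tensor power is a Leibniz n-algebra in its own right, so the locale can be
  interpreted with it in place of \<open>L\<close>.\<close>

lemma leibniz_algebra_forget_star: "leibniz_algebra p K (forget n (Suc k) S)"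
proof -
  interpret S: leibniz_forget n K S k p
    by (intro leibniz_forget.intro leibniz_algebra_pos.intro leibniz_algebra_star_power
        leibniz_algebra_pos_axioms.intro leibniz_forget_axioms.intro n_pos n_ge_2 p_eq)
  show ?thesis by (rule S.leibniz_algebra_forget)
qed

lemma star_nest_last_multilinear:
  "multilinear K p L S (\<lambda>xs. star K n L (nest_last n k (bracket L) xs))"
  unfolding p_eq
  by (rule nest_last_multilinear[OF mod_L n_pos
        nested_multilinear[OF mod_L n_pos bracket_multilinear] star_multilinear])

lemma star_bracket_closed: "ts \<in> tuples n (carrier S) \<Longrightarrow> bracket S ts \<in> carrier S"
  by (simp only: bracket_star_power star_closed map_star_map_tuples)

text \<open>Since \<open>star_map\<close> respects n-ary brackets it commutes with
  \<open>nest_last\<close>; the outermost bracket then becomes \<open>star\<close>.\<close>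

lemma nested_star_power:
  assumes "ts \<in> tuples p (carrier S)"
  shows "nested n (Suc k) (bracket S) ts =
    star K n L (nest_last n k (bracket L) (map (star_map K n L) ts))"
proof -
  note ts = assms[unfolded p_eq]
  note S = nested_map[where f = "star_map K n L" and c = "bracket L",
      OF n_pos star_bracket_closed star_map_bracket]
  have nl: "nest_last n k (bracket S) ts \<in> tuples n (carrier S)"
    by (rule nest_last_tuples[OF n_pos ts]) (rule S[THEN conjunct1])
  have "map (star_map K n L) (nest_last n k (bracket S) ts) =
      nest_last n k (bracket L) (map (star_map K n L) ts)"
    by (rule map_nest_last[where f = "star_map K n L" and c = "bracket L", OF n_pos star_bracket_closed
          star_map_bracket ts])
  then show ?thesis
    unfolding nested_Suc bracket_star_power[OF nl] by (rule arg_cong)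
qed

lemma star_map_nested_star_power:
  assumes "ts \<in> tuples p (carrier S)"
  shows "star_map K n L (nested n (Suc k) (bracket S) ts) =
    nested n (Suc k) (bracket L) (map (star_map K n L) ts)"
  unfolding nested_star_power[OF assms] unfolding nested_Suc
  by (rule star_map_star[OF nest_last_closed[OF map_star_map_tuples[OF assms]]])

end

section \<open>The central extension and the comparison map\<close>

lemma (in leibniz_algebra_pos) star_map_surj:
  assumes "perfect n K L"
  shows "star_map K n L ` carrier S = carrier L"
proof
  show "star_map K n L ` carrier S \<subseteq> carrier L" using star_map_closed by blast
  have "bracket L ` tuples n (carrier L) \<subseteq> star_map K n L ` carrier S"
    using star_map_star star_closed by (metis (no_types, lifting) image_eqI image_subsetI)
  then show "carrier L \<subseteq> star_map K n L ` carrier S"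
    using lin_span_carrier_subset[OF assms[unfolded perfect_def]
        submodule_image[OF module_star_power mod_L star_map_lin_hom]] by blast
qed

lemma (in leibniz_forget) central_extension_forget_star:
  assumes "perfect n K L"
  shows "central_extension p K (forget n (Suc k) S) (forget n (Suc k) L) (star_map K n L)"
  unfolding central_extension_def
proof (intro conjI)
  show "leibniz_hom p K (forget n (Suc k) S) (forget n (Suc k) L) (star_map K n L)"
    unfolding leibniz_hom_def lin_hom_forget forget_simps
    using leibniz_algebra_forget leibniz_algebra_forget_star star_map_lin_hom
      star_map_nested_star_power by blast
  show "star_map K n L ` carrier (forget n (Suc k) S) = carrier (forget n (Suc k) L)"
    unfolding forget_simps by (rule star_map_surj[OF assms])
  show "a_kernel (forget n (Suc k) S) (forget n (Suc k) L) (star_map K n L) \<subseteq>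
      leibniz_center p (forget n (Suc k) S)"
  proof
    fix t assume "t \<in> a_kernel (forget n (Suc k) S) (forget n (Suc k) L) (star_map K n L)"
    then have t: "t \<in> carrier S" "star_map K n L t = \<zero>\<^bsub>L\<^esub>"
      by (simp_all add: a_kernel_def' forget_simps)
    have "nested n (Suc k) (bracket S) ts = \<zero>\<^bsub>S\<^esub>"
      if ts: "ts \<in> tuples p (carrier S)" and "t \<in> set ts" for ts
      unfolding nested_star_power[OF ts]
    proof (rule multilinear_eq_zero[OF mod_L module_star_power star_nest_last_multilinear])
      show "map (star_map K n L) ts \<in> tuples p (carrier L)" by (rule map_star_map_tuples[OF ts])
      show "\<zero>\<^bsub>L\<^esub> \<in> set (map (star_map K n L) ts)" using t(2) that(2) by force
    qed
    then show "t \<in> leibniz_center p (forget n (Suc k) S)"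
      using t(1) unfolding leibniz_center_def forget_simps by blast
  qed
qed

theorem mainTheorem7:
  fixes K :: "('k, 'c) ring_scheme" and L :: "('k, 'a, 'm) leibniz_scheme"
    and n k p :: nat
  assumes "field K" and "n \<ge> 2" and "k \<ge> 1" and "p = k * (n - 1) + 1"
    and "leibniz_algebra n K L" and "perfect n K L"
  shows "central_extension p K (forget n k (star_power K n L)) (forget n k L) (star_map K n L)
    \<and> (\<exists>\<phi>. leibniz_hom p K (star_power K p (forget n k L)) (forget n k (star_power K n L)) \<phi>
        \<and> (\<forall>t\<in>carrier (star_power K p (forget n k L)).
              star_map K n L (\<phi> t) = star_map K p (forget n k L) t)
        \<and> (\<forall>\<psi>. leibniz_hom p K (star_power K p (forget n k L)) (forget n k (star_power K n L)) \<psi>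
              \<and> (\<forall>t\<in>carrier (star_power K p (forget n k L)).
                    star_map K n L (\<psi> t) = star_map K p (forget n k L) t)
              \<longrightarrow> (\<forall>t\<in>carrier (star_power K p (forget n k L)). \<psi> t = \<phi> t))
        \<and> (\<forall>xs\<in>tuples p (carrier L).
              \<phi> (star K p (forget n k L) xs)
                = star K n L (take (n - 1) xs @ [nested n (k - 1) (bracket L) (drop (n - 1) xs)]))
        \<and> \<phi> ` carrier (star_power K p (forget n k L)) = carrier (forget n k (star_power K n L)))"
proof -
  \<comment> \<open>The depth of the inner nesting is \<open>l = k - 1\<close>, matching the last
    factor in the formula for \<phi>.\<close>
  obtain l where k: "k = Suc l" using assms(3) by (cases k) auto
  interpret A: leibniz_forget n K L l p
    by (intro leibniz_forget.intro leibniz_algebra_pos.intro leibniz_algebra_pos_axioms.intro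
        leibniz_forget_axioms.intro assms(5) assms(2)) (use assms(2,4) k in simp_all)
  let ?P = "forget n k L" and ?T = "star_power K n L" and ?d = "star_map K n L"
  \<comment> \<open>A second instance of the tensor power theory, now of arity p over
    \<open>?P\<close>; its universal property is the source of \<phi>.\<close>
  interpret P: leibniz_algebra_pos p K ?P
    using A.leibniz_algebra_forget k A.p_eq
    by (intro leibniz_algebra_pos.intro leibniz_algebra_pos_axioms.intro) simp_all
  let ?Tp = "star_power K p ?P" and ?dp = "star_map K p ?P"
  define F where "F xs = star K n L (nest_last n l (bracket L) xs)" for xs
  have F_mult: "multilinear K p L ?T F"
    unfolding F_def by (rule A.star_nest_last_multilinear)
  have F_bal: "leibniz_balanced p ?P ?T F"
    unfolding F_def k by (rule A.balanced_nest_last[OF A.module_star_power A.star_multilinear A.star_balanced])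
  have nested_T: "bracket (forget n k ?T) ts = F (map ?d ts)" if "ts \<in> tuples p (carrier ?T)" for ts
    unfolding F_def k forget_simps by (rule A.nested_star_power[OF that])
  have bracket_P: "bracket ?P xs = bracket L (nest_last n l (bracket L) xs)" for xs
    unfolding k forget_simps nested_Suc by (rule refl)
  obtain \<phi> where \<phi>_lin: "\<phi> \<in> lin_hom K ?Tp ?T"
    and \<phi>_star: "\<And>xs. xs \<in> tuples p (carrier L) \<Longrightarrow> \<phi> (star K p ?P xs) = F xs"
    using P.star_lift[OF A.module_star_power _ F_bal] F_mult
    unfolding multilinear_forget forget_simps by blast
  have d_lin: "?d \<in> lin_hom K ?T L" by (rule A.star_map_lin_hom)
  have dp_lin: "?dp \<in> lin_hom K ?Tp L"
    using P.star_map_lin_hom unfolding lin_hom_forget .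
  \<comment> \<open>On a generator, \<open>?d\<close> turns the outer \<open>star\<close> back into
    a bracket and so completes the nested p-ary bracket.\<close>
  have over: "?d (\<phi> t) = ?dp t" if t: "t \<in> carrier ?Tp" for t
  proof (rule lin_hom_eq_on_span[OF P.module_star_power A.mod_L lin_hom_comp[OF \<phi>_lin d_lin] dp_lin
        P.lin_span_star _ t])
    fix s assume "s \<in> star K p ?P ` tuples p (carrier ?P)"
    then obtain xs where xs: "xs \<in> tuples p (carrier L)" and s: "s = star K p ?P xs"
      unfolding forget_simps by blast
    have "?d (\<phi> s) = bracket ?P xs"
      unfolding s \<phi>_star[OF xs] F_def bracket_P by (rule A.star_map_star[OF A.nest_last_closed[OF xs]])
    also have "\<dots> = ?dp s"
      unfolding s by (rule P.star_map_star[symmetric]) (simp add: forget_simps xs)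
    finally show "?d (\<phi> s) = ?dp s" .
  qed
  have leib_Tp: "leibniz_algebra p K ?Tp" by (rule P.leibniz_algebra_star_power)
  have leib_T: "leibniz_algebra p K (forget n k ?T)"
    unfolding k by (rule A.leibniz_algebra_forget_star)
  \<comment> \<open>The right-hand side does not mention \<open>\<psi>\<close>. This independence
    yields both the homomorphism property of \<phi> and its uniqueness.\<close>
  have forced: "bracket (forget n k ?T) (map \<psi> ts) = F (map ?dp ts)"
    if "\<psi> \<in> lin_hom K ?Tp ?T" "\<And>t. t \<in> carrier ?Tp \<Longrightarrow> ?d (\<psi> t) = ?dp t" "ts \<in> tuples p (carrier ?Tp)"
    for \<psi> ts
  proof -
    have "map \<psi> ts \<in> tuples p (carrier ?T)"
      by (rule tuples_map[OF lin_hom_closed[OF that(1)] that(3)])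
    moreover have "map ?d (map \<psi> ts) = map ?dp ts"
      using that(2,3) by (auto simp: tuples_def)
    ultimately show ?thesis using nested_T by metis
  qed
  have bracket_Tp: "bracket ?Tp ts = star K p ?P (map ?dp ts)" "map ?dp ts \<in> tuples p (carrier L)"
    if "ts \<in> tuples p (carrier ?Tp)" for ts
    using P.bracket_star_power[OF that] P.map_star_map_tuples[OF that] by (simp_all add: forget_simps)
  \<comment> \<open>A bracket in \<open>?Tp\<close> is a \<open>star\<close> element with entries
    from the image of \<open>?dp\<close>, where \<phi> takes the value prescribed by
    \<open>F\<close>; by \<open>forced\<close> this is the bracket of the images.\<close>
  have \<phi>_hom: "leibniz_hom p K ?Tp (forget n k ?T) \<phi>"
    unfolding leibniz_hom_def lin_hom_forget
    using leib_Tp leib_T \<phi>_lin forced[OF \<phi>_lin over] bracket_Tp \<phi>_star by simp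
  have span_nested: "lin_span K L (nested n j (bracket L) ` tuples (j * (n - 1) + 1) (carrier L)) = carrier L" for j
    by (rule lin_span_nested[OF A.mod_L A.n_pos A.bracket_multilinear assms(6)[unfolded perfect_def]])
  \<comment> \<open>Perfectness for arity p makes \<open>?dp\<close> surjective, which is needed to
    write every generator of \<open>?Tp\<close> as a bracket.\<close>
  have "perfect p K ?P"
    unfolding perfect_def lin_span_cong[OF forget_simps(1-4)] forget_simps assms(4) by (rule span_nested)
  from P.star_map_surj[OF this] have dp_surj: "?dp ` carrier ?Tp = carrier L"
    unfolding forget_simps .
  have unique: "\<psi> t = \<phi> t"
    if \<psi>: "leibniz_hom p K ?Tp (forget n k ?T) \<psi>" "\<And>t. t \<in> carrier ?Tp \<Longrightarrow> ?d (\<psi> t) = ?dp t"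
      and t: "t \<in> carrier ?Tp" for \<psi> t
  proof -
    have \<psi>_lin: "\<psi> \<in> lin_hom K ?Tp ?T"
      using \<psi>(1) unfolding leibniz_hom_def lin_hom_forget by blast
    show ?thesis
    proof (rule lin_hom_eq_on_span[OF P.module_star_power A.module_star_power \<psi>_lin \<phi>_lin
          P.lin_span_star _ t])
      fix s assume "s \<in> star K p ?P ` tuples p (carrier ?P)"
      \<comment> \<open>The entries are regarded as values of \<open>?dp\<close> in order to be
        lifted to \<open>ts\<close>; then \<open>s\<close> is a bracket in \<open>?Tp\<close> and
        its image is forced.\<close>
      then obtain xs where xs: "xs \<in> tuples p (?dp ` carrier ?Tp)" and s: "s = star K p ?P xs"
        unfolding forget_simps dp_surj by blast
      obtain ts where ts: "ts \<in> tuples p (carrier ?Tp)" "xs = map ?dp ts"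
        using xs unfolding tuples_image by blast
      have s_br: "s = bracket ?Tp ts" unfolding s ts(2) by (rule bracket_Tp(1)[OF ts(1), symmetric])
      have "\<psi> s = bracket (forget n k ?T) (map \<psi> ts)"
        using \<psi>(1) ts(1) unfolding leibniz_hom_def s_br by blast
      also have "\<dots> = bracket (forget n k ?T) (map \<phi> ts)"
        by (simp only: forced[OF \<psi>_lin \<psi>(2) ts(1)] forced[OF \<phi>_lin over ts(1)])
      also have "\<dots> = \<phi> s"
        using \<phi>_hom ts(1) unfolding leibniz_hom_def s_br by simp
      finally show "\<psi> s = \<phi> s" .
    qed
  qed
  have surj: "\<phi> ` carrier ?Tp = carrier ?T"
  proof
    show "\<phi> ` carrier ?Tp \<subseteq> carrier ?T" using lin_hom_closed[OF \<phi>_lin] by blast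
    \<comment> \<open>The image of \<phi> contains every generator whose last factor is an
      \<open>l\<close>-fold nested bracket, and such brackets span L.\<close>
    have "star K n L us \<in> \<phi> ` carrier ?Tp" if "us \<in> tuples n (carrier L)" for us
    proof (rule nest_last_span[OF A.mod_L A.module_star_power A.n_pos A.star_multilinear span_nested
          submodule_image[OF P.module_star_power A.module_star_power \<phi>_lin] _ that])
      fix xs assume "xs \<in> tuples (Suc l * (n - 1) + 1) (carrier L)"
      then have xs: "xs \<in> tuples p (carrier L)" unfolding A.p_eq .
      have "star K p ?P xs \<in> carrier ?Tp"
        by (rule P.star_closed) (simp add: forget_simps xs)
      then show "star K n L (nest_last n l (bracket L) xs) \<in> \<phi> ` carrier ?Tp"
        using \<phi>_star[OF xs] unfolding F_def by (metis imageI)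
    qed
    then show "carrier ?T \<subseteq> \<phi> ` carrier ?Tp"
      by (intro lin_span_carrier_subset[OF A.lin_span_star
            submodule_image[OF P.module_star_power A.module_star_power \<phi>_lin]]) blast
  qed
  have central: "central_extension p K (forget n k ?T) ?P ?d"
    unfolding k by (rule A.central_extension_forget_star[OF assms(6)])
  have formula: "\<phi> (star K p ?P xs) =
      star K n L (take (n - 1) xs @ [nested n (k - 1) (bracket L) (drop (n - 1) xs)])"
    if "xs \<in> tuples p (carrier L)" for xs
    using \<phi>_star[OF that] by (simp add: F_def nest_last_def k)
  show ?thesis
    using central \<phi>_hom over unique formula surj unfolding forget_simps(1)
    by (intro conjI exI[of _ \<phi>]) blast+
qed

end
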